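(* Let $\theta$ and $\tau$ be commuting ergodic measure preserving transformations of a non-atomic probability space which generate a free $\mathbb N_0^2$-action. For $1\le p<\infty$, let $U$ and $V$ be their corresponding isometries induced on $L_p$, i.e. $Uf=f\circ\theta$, $Vf=f\circ\tau$. Then: (i) $(I-U)L_p+(I-V)L_p$ is not closed in $L_p$ (both for the real and for the complex $L_p$). (ii) There exists a real function $f\in L_p$ with integral zero such that $$\limsup_{n\to\infty}\Big\|\frac1n\sum_{k=0}^{n-1}\sum_{j=0}^{n-1}U^kV^jf\Big\|_p>0.$$
   Context: $\mathbb N_0=\{0,1,2,\dots\}$. The transformations $\theta,\tau$ are not assumed invertible. The $\mathbb N_0^2$-action $(k,j)\mapsto\theta^k\tau^j$ on the probability space $(\Omega,\mathbb P)$ is free if for all distinct $(k,j),(k',j')\in\mathbb N_0^2$ the set $\{x\in\Omega:\theta^k\tau^jx=\theta^{k'}\tau^{j'}x\}$ has measure zero. *)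

theory Defs
  imports "HOL-Probability.Probability"
begin

section \<open>Measure preserving transformations\<close>

definition measure_preserving :: "'a measure \<Rightarrow> ('a \<Rightarrow> 'a) \<Rightarrow> bool" where
  "measure_preserving M T \<longleftrightarrow> T \<in> measurable M M \<and> distr M M T = M"

definition ergodic :: "'a measure \<Rightarrow> ('a \<Rightarrow> 'a) \<Rightarrow> bool" where
  "ergodic M T \<longleftrightarrow>
     (\<forall>A\<in>sets M. T -` A \<inter> space M = A \<longrightarrow> measure M A = 0 \<or> measure M (space M - A) = 0)"

definition non_atomic :: "'a measure \<Rightarrow> bool" where
  "non_atomic M \<longleftrightarrow>
     \<not> (\<exists>A\<in>sets M. emeasure M A > 0 \<and>
          (\<forall>B\<in>sets M. B \<subseteq> A \<longrightarrow> emeasure M B = 0 \<or> emeasure M (A - B) = 0))"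

text \<open>Coincidence sets need not be measurable on an arbitrary probability space;
  having measure zero means being contained in a measurable null set.\<close>

definition free_action :: "'a measure \<Rightarrow> ('a \<Rightarrow> 'a) \<Rightarrow> ('a \<Rightarrow> 'a) \<Rightarrow> bool" where
  "free_action M T S \<longleftrightarrow>
     (\<forall>k j k' j'. (k, j) \<noteq> (k', j') \<longrightarrow>
        (AE x in M. (T ^^ k) ((S ^^ j) x) \<noteq> (T ^^ k') ((S ^^ j') x)))"


section \<open>The spaces $L_p$\<close>

definition Lp_fun :: "'a measure \<Rightarrow> real \<Rightarrow> ('a \<Rightarrow> 'b::{banach, second_countable_topology}) set" where
  "Lp_fun M p = {f \<in> borel_measurable M. integrable M (\<lambda>x. norm (f x) powr p)}"

definition Lp_norm :: "'a measure \<Rightarrow> real \<Rightarrow> ('a \<Rightarrow> 'b::{banach, second_countable_topology}) \<Rightarrow> real" where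
  "Lp_norm M p f = (\<integral>x. norm (f x) powr p \<partial>M) powr (1 / p)"

definition Lp_rel :: "'a measure \<Rightarrow> real \<Rightarrow>
    (('a \<Rightarrow> 'b) \<times> ('a \<Rightarrow> 'b::{banach, second_countable_topology})) set" where
  "Lp_rel M p = {(f, g). f \<in> Lp_fun M p \<and> g \<in> Lp_fun M p \<and> (AE x in M. f x = g x)}"

definition Lp :: "'a measure \<Rightarrow> real \<Rightarrow> ('a \<Rightarrow> 'b::{banach, second_countable_topology}) set set" where
  "Lp M p = Lp_fun M p // Lp_rel M p"

definition Lp_class :: "'a measure \<Rightarrow> real \<Rightarrow> ('a \<Rightarrow> 'b::{banach, second_countable_topology}) \<Rightarrow> ('a \<Rightarrow> 'b) set" where
  "Lp_class M p f = Lp_rel M p `` {f}"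

definition Lp_dist :: "'a measure \<Rightarrow> real \<Rightarrow> ('a \<Rightarrow> 'b::{banach, second_countable_topology}) set \<Rightarrow>
    ('a \<Rightarrow> 'b) set \<Rightarrow> real" where
  "Lp_dist M p F G = Lp_norm M p (\<lambda>x. (SOME f. f \<in> F) x - (SOME g. g \<in> G) x)"

definition Lp_topology :: "'a measure \<Rightarrow> real \<Rightarrow> ('a \<Rightarrow> 'b::{banach, second_countable_topology}) set topology" where
  "Lp_topology M p = Metric_space.mtopology (Lp M p) (Lp_dist M p)"

lemma Lp_funI:
  "f \<in> borel_measurable M \<Longrightarrow> integrable M (\<lambda>x. norm (f x) powr p) \<Longrightarrow> f \<in> Lp_fun M p"
  by (simp add: Lp_fun_def)

lemma Lp_funD:
  assumes "f \<in> Lp_fun M p"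
  shows "f \<in> borel_measurable M" "integrable M (\<lambda>x. norm (f x) powr p)"
  using assms by (auto simp: Lp_fun_def)

lemma Lp_norm_nonneg [simp]: "0 \<le> Lp_norm M p f"
  by (simp add: Lp_norm_def)

lemma Lp_norm_powr:
  assumes "1 \<le> p"
  shows "Lp_norm M p f powr p = (\<integral>x. norm (f x) powr p \<partial>M)"
  using assms by (simp add: Lp_norm_def powr_powr)

lemma convex_on_powr_nonneg:
  assumes p: "1 \<le> (p::real)"
  shows "convex_on {0..} (\<lambda>x. x powr p)"
proof (rule convex_onI)
  fix t x y :: real
  assume t: "0 < t" "t < 1" and xy: "x \<in> {0..}" "y \<in> {0..}"
  have *: "(s * z) powr p \<le> s * z powr p" if "0 < s" "s < 1" for s z :: real
    using that p powr_mono'[of 1 p s] by (simp add: powr_mult mult_right_mono)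
  show "((1 - t) *\<^sub>R x + t *\<^sub>R y) powr p \<le> (1 - t) * x powr p + t * y powr p"
  proof (cases "x = 0 \<or> y = 0")
    case True
    then show ?thesis using *[of t y] *[of "1 - t" x] t by auto
  next
    case False
    then show ?thesis
      using convex_onD[OF powr_convex[OF p], of t x y] t xy by auto
  qed
qed simp

lemma Lp_fun_minkowski_aux:
  fixes f g :: "'a \<Rightarrow> 'b::{banach, second_countable_topology}"
  assumes p: "1 \<le> p" and f: "f \<in> Lp_fun M p" and g: "g \<in> Lp_fun M p"
    and a: "0 < a" and b: "0 < b"
  shows "norm (f x + g x) powr p \<le>
    (a + b) powr p * (a / (a + b) * (norm (f x) powr p / a powr p)
                    + b / (a + b) * (norm (g x) powr p / b powr p))"
proof -
  have conv: "convex_on {0::real..} (\<lambda>x. x powr p)"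
    by (rule convex_on_powr_nonneg[OF p])
  let ?t = "b / (a + b)"
  have t: "0 \<le> ?t" "?t \<le> 1" "1 - ?t = a / (a + b)"
    using a b by (auto simp: field_simps)
  have "norm (f x + g x) powr p \<le> (norm (f x) + norm (g x)) powr p"
    using p by (intro powr_mono2 norm_triangle_ineq) auto
  also have "norm (f x) + norm (g x) =
      (a + b) * ((1 - ?t) *\<^sub>R (norm (f x) / a) + ?t *\<^sub>R (norm (g x) / b))"
  proof -
    have "a + b \<noteq> 0" "a \<noteq> 0" "b \<noteq> 0" using a b by auto
    then show ?thesis unfolding t(3) by (simp add: distrib_left)
  qed
  also have "\<dots> powr p = (a + b) powr p *
      ((1 - ?t) *\<^sub>R (norm (f x) / a) + ?t *\<^sub>R (norm (g x) / b)) powr p"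
    by (rule powr_mult)
  also have "\<dots> \<le> (a + b) powr p *
      ((1 - ?t) * (norm (f x) / a) powr p + ?t * (norm (g x) / b) powr p)"
    using convex_onD[OF conv t(1,2), of "norm (f x) / a" "norm (g x) / b"] a b
    by (intro mult_left_mono) auto
  finally show ?thesis
    unfolding t(3) using a b by (simp add: powr_divide)
qed

lemma Lp_fun_add:
  fixes f g :: "'a \<Rightarrow> 'b::{banach, second_countable_topology}"
  assumes p: "1 \<le> p" and f: "f \<in> Lp_fun M p" and g: "g \<in> Lp_fun M p"
  shows "(\<lambda>x. f x + g x) \<in> Lp_fun M p"
proof (rule Lp_funI)
  note [measurable] = Lp_funD(1)[OF f] Lp_funD(1)[OF g]
  show "(\<lambda>x. f x + g x) \<in> borel_measurable M" by measurable
  show "integrable M (\<lambda>x. norm (f x + g x) powr p)"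
  proof (rule Bochner_Integration.integrable_bound)
    show "integrable M (\<lambda>x. (1 + 1) powr p * (1 / (1 + 1) * (norm (f x) powr p / 1 powr p)
                    + 1 / (1 + 1) * (norm (g x) powr p / 1 powr p)))"
      using Lp_funD(2)[OF f] Lp_funD(2)[OF g] by auto
    show "AE x in M. norm (norm (f x + g x) powr p) \<le> norm ((1 + 1) powr p *
        (1 / (1 + 1) * (norm (f x) powr p / 1 powr p) + 1 / (1 + 1) * (norm (g x) powr p / 1 powr p)))"
      using Lp_fun_minkowski_aux[OF p f g, of 1 1]
      by (intro AE_I2) (smt (verit) powr_ge_zero real_norm_def zero_less_one)
  qed measurable
qed

lemma Lp_norm_triangle:
  fixes f g :: "'a \<Rightarrow> 'b::{banach, second_countable_topology}"
  assumes p: "1 \<le> p" and f: "f \<in> Lp_fun M p" and g: "g \<in> Lp_fun M p"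
  shows "Lp_norm M p (\<lambda>x. f x + g x) \<le> Lp_norm M p f + Lp_norm M p g"
proof -
  have *: "Lp_norm M p (\<lambda>x. f x + g x) \<le> a + b"
    if a: "Lp_norm M p f < a" and b: "Lp_norm M p g < b" for a b
  proof -
    have a0: "0 < a" and b0: "0 < b"
      using a b Lp_norm_nonneg[of M p f] Lp_norm_nonneg[of M p g] by linarith+
    have fa: "(\<integral>x. norm (f x) powr p \<partial>M) \<le> a powr p"
      unfolding Lp_norm_powr[OF p, symmetric] using a p by (intro powr_mono2) auto
    have gb: "(\<integral>x. norm (g x) powr p \<partial>M) \<le> b powr p"
      unfolding Lp_norm_powr[OF p, symmetric] using b p by (intro powr_mono2) auto
    have "(\<integral>x. norm (f x + g x) powr p \<partial>M) \<le>
       (\<integral>x. (a + b) powr p * (a / (a + b) * (norm (f x) powr p / a powr p)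
                    + b / (a + b) * (norm (g x) powr p / b powr p)) \<partial>M)"
      using Lp_funD(2)[OF f] Lp_funD(2)[OF g] Lp_funD(2)[OF Lp_fun_add[OF p f g]]
      by (intro integral_mono Lp_fun_minkowski_aux[OF p f g a0 b0]) auto
    also have "\<dots> = (a + b) powr p * (a / (a + b) * ((\<integral>x. norm (f x) powr p \<partial>M) / a powr p)
                    + b / (a + b) * ((\<integral>x. norm (g x) powr p \<partial>M) / b powr p))"
      using Lp_funD(2)[OF f] Lp_funD(2)[OF g] by simp
    also have "\<dots> \<le> (a + b) powr p * (a / (a + b) * 1 + b / (a + b) * 1)"
      using fa gb a0 b0 by (intro mult_left_mono add_mono) auto
    also have "\<dots> = (a + b) powr p"
      using a0 b0 by (simp add: add_divide_distrib[symmetric])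
    finally have "Lp_norm M p (\<lambda>x. f x + g x) \<le> ((a + b) powr p) powr (1 / p)"
      unfolding Lp_norm_def using p by (intro powr_mono2) auto
    then show ?thesis using p a0 b0 by (simp add: powr_powr)
  qed
  show ?thesis
  proof (rule field_le_epsilon)
    fix e :: real assume "0 < e"
    then show "Lp_norm M p (\<lambda>x. f x + g x) \<le> Lp_norm M p f + Lp_norm M p g + e"
      using *[of "Lp_norm M p f + e / 2" "Lp_norm M p g + e / 2"] by simp
  qed
qed

lemma Lp_fun_uminus:
  "f \<in> Lp_fun M p \<Longrightarrow> (\<lambda>x. - f x) \<in> Lp_fun M p"
  by (auto simp: Lp_fun_def)

lemma Lp_fun_diff:
  assumes "1 \<le> p" "f \<in> Lp_fun M p" "g \<in> Lp_fun M p"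
  shows "(\<lambda>x. f x - g x) \<in> Lp_fun M p"
  using Lp_fun_add[OF assms(1,2) Lp_fun_uminus[OF assms(3)]] by simp

lemma Lp_norm_eq_0_iff:
  assumes p: "1 \<le> p" and f: "f \<in> Lp_fun M p"
  shows "Lp_norm M p f = 0 \<longleftrightarrow> (AE x in M. f x = 0)"
proof -
  have "Lp_norm M p f = 0 \<longleftrightarrow> (\<integral>x. norm (f x) powr p \<partial>M) = 0"
    by (simp add: Lp_norm_def)
  also have "\<dots> \<longleftrightarrow> (AE x in M. norm (f x) powr p = 0)"
    using Lp_funD(2)[OF f] by (intro integral_nonneg_eq_0_iff_AE) auto
  finally show ?thesis by simp
qed

lemma Lp_norm_cong_AE:
  assumes "f \<in> borel_measurable M" "g \<in> borel_measurable M" "AE x in M. f x = g x"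
  shows "Lp_norm M p f = Lp_norm M p g"
proof -
  have "(\<integral>x. norm (f x) powr p \<partial>M) = (\<integral>x. norm (g x) powr p \<partial>M)"
    using assms by (intro integral_cong_AE) auto
  then show ?thesis by (simp add: Lp_norm_def)
qed

lemma equiv_Lp_rel: "equiv (Lp_fun M p) (Lp_rel M p)"
proof (rule equivI)
  show "trans (Lp_rel M p)"
    by (rule transI) (auto simp: Lp_rel_def elim: AE_mp)
qed (auto simp: Lp_rel_def refl_on_def sym_def)

lemma Lp_some:
  assumes "F \<in> Lp M p"
  shows "(SOME f. f \<in> F) \<in> F" "(SOME f. f \<in> F) \<in> Lp_fun M p"
proof -
  show *: "(SOME f. f \<in> F) \<in> F"
    using in_quotient_imp_non_empty[OF equiv_Lp_rel assms[unfolded Lp_def]]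
    by (simp add: some_in_eq)
  then show "(SOME f. f \<in> F) \<in> Lp_fun M p"
    using in_quotient_imp_subset[OF equiv_Lp_rel assms[unfolded Lp_def]] by blast
qed

lemma Metric_space_Lp:
  assumes p: "1 \<le> p"
  shows "Metric_space (Lp M p :: ('a \<Rightarrow> 'b::{banach, second_countable_topology}) set set) (Lp_dist M p)"
proof
  fix F G :: "('a \<Rightarrow> 'b) set"
  show "0 \<le> Lp_dist M p F G" by (simp add: Lp_dist_def)
  show "Lp_dist M p F G = Lp_dist M p G F"
    by (simp add: Lp_dist_def Lp_norm_def norm_minus_commute)
next
  fix F G :: "('a \<Rightarrow> 'b) set"
  assume F: "F \<in> Lp M p" and G: "G \<in> Lp M p"
  let ?f = "SOME f. f \<in> F" and ?g = "SOME g. g \<in> G"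
  have "Lp_dist M p F G = 0 \<longleftrightarrow> (?f, ?g) \<in> Lp_rel M p"
    unfolding Lp_dist_def Lp_norm_eq_0_iff[OF p Lp_fun_diff[OF p Lp_some(2)[OF F] Lp_some(2)[OF G]]]
    using Lp_some(2)[OF F] Lp_some(2)[OF G] by (simp add: Lp_rel_def)
  also have "\<dots> \<longleftrightarrow> F = G"
    using quotient_eq_iff[OF equiv_Lp_rel F[unfolded Lp_def] G[unfolded Lp_def]
        Lp_some(1)[OF F] Lp_some(1)[OF G]] by simp
  finally show "Lp_dist M p F G = 0 \<longleftrightarrow> F = G" .
next
  fix F G H :: "('a \<Rightarrow> 'b) set"
  assume F: "F \<in> Lp M p" and G: "G \<in> Lp M p" and H: "H \<in> Lp M p"
  show "Lp_dist M p F H \<le> Lp_dist M p F G + Lp_dist M p G H"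
    using Lp_norm_triangle[OF p Lp_fun_diff[OF p Lp_some(2)[OF F] Lp_some(2)[OF G]]
        Lp_fun_diff[OF p Lp_some(2)[OF G] Lp_some(2)[OF H]]]
    by (simp add: Lp_dist_def)
qed

lemma Lp_class_in_Lp: "f \<in> Lp_fun M p \<Longrightarrow> Lp_class M p f \<in> Lp M p"
  by (simp add: Lp_class_def Lp_def quotientI)

lemma Lp_class_eq_iff:
  assumes "f \<in> Lp_fun M p" "g \<in> Lp_fun M p"
  shows "Lp_class M p f = Lp_class M p g \<longleftrightarrow> (AE x in M. f x = g x)"
  unfolding Lp_class_def eq_equiv_class_iff[OF equiv_Lp_rel assms]
  using assms by (simp add: Lp_rel_def)

lemma Lp_dist_class:
  assumes p: "1 \<le> p" and f: "f \<in> Lp_fun M p" and g: "g \<in> Lp_fun M p"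
  shows "Lp_dist M p (Lp_class M p f) (Lp_class M p g) = Lp_norm M p (\<lambda>x. f x - g x)"
proof -
  let ?f = "SOME h. h \<in> Lp_class M p f" and ?g = "SOME h. h \<in> Lp_class M p g"
  have "?f \<in> Lp_class M p f" "?g \<in> Lp_class M p g"
    using Lp_some(1)[OF Lp_class_in_Lp[OF f]] Lp_some(1)[OF Lp_class_in_Lp[OF g]] .
  then have ae: "AE x in M. f x = ?f x" "AE x in M. g x = ?g x"
    by (auto simp: Lp_class_def Lp_rel_def)
  note [measurable] = Lp_funD(1)[OF f] Lp_funD(1)[OF g]
    Lp_funD(1)[OF Lp_some(2)[OF Lp_class_in_Lp[OF f]]]
    Lp_funD(1)[OF Lp_some(2)[OF Lp_class_in_Lp[OF g]]]
  have "AE x in M. ?f x - ?g x = f x - g x" using ae by eventually_elim simp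
  then show ?thesis
    unfolding Lp_dist_def by (intro Lp_norm_cong_AE) measurable
qed


section \<open>Koopman operators\<close>

text \<open>The operators are given on functions. By the three lemmas below they respect almost
  everywhere equality, and hence define isometries of the quotient.\<close>

definition koopman :: "('a \<Rightarrow> 'a) \<Rightarrow> ('a \<Rightarrow> 'b) \<Rightarrow> 'a \<Rightarrow> 'b" where
  "koopman T f = f \<circ> T"

lemma AE_koopman:
  assumes "measure_preserving M T" "AE x in M. f x = g x"
  shows "AE x in M. koopman T f x = koopman T g x"
proof -
  have T: "T \<in> measurable M M" "distr M M T = M"
    using assms(1) by (auto simp: measure_preserving_def)
  have "AE x in distr M M T. f x = g x" by (subst T(2)) (rule assms(2))
  then have "AE x in M. f (T x) = g (T x)"
    using T(1) by (rule AE_distrD[rotated])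
  then show ?thesis by (simp add: koopman_def)
qed

lemma koopman_Lp_fun:
  assumes "measure_preserving M T" "f \<in> Lp_fun M p"
  shows "koopman T f \<in> Lp_fun M p"
proof -
  have T [measurable]: "T \<in> measurable M M" and d: "distr M M T = M"
    using assms(1) by (auto simp: measure_preserving_def)
  note [measurable] = Lp_funD(1)[OF assms(2)]
  have "integrable (distr M M T) (\<lambda>x. norm (f x) powr p)"
    using Lp_funD(2)[OF assms(2)] d by simp
  then have "integrable M (\<lambda>x. norm (f (T x)) powr p)"
    by (rule integrable_distr[OF T])
  then show ?thesis by (intro Lp_funI) (auto simp: koopman_def)
qed

lemma Lp_norm_koopman:
  assumes "measure_preserving M T" "f \<in> Lp_fun M p"
  shows "Lp_norm M p (koopman T f) = Lp_norm M p f"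
proof -
  have T [measurable]: "T \<in> measurable M M" and d: "distr M M T = M"
    using assms(1) by (auto simp: measure_preserving_def)
  note [measurable] = Lp_funD(1)[OF assms(2)]
  have "(\<integral>x. norm (f (T x)) powr p \<partial>M) = (\<integral>x. norm (f x) powr p \<partial>distr M M T)"
    by (rule integral_distr[symmetric]) auto
  then show ?thesis by (simp add: Lp_norm_def koopman_def d)
qed

text \<open>$(I-U)L_p + (I-V)L_p$, where $U$ and $V$ are induced by \<open>T\<close> and \<open>S\<close>.\<close>

definition Lp_coboundaries :: "'a measure \<Rightarrow> real \<Rightarrow> ('a \<Rightarrow> 'a) \<Rightarrow> ('a \<Rightarrow> 'a) \<Rightarrow>
    ('a \<Rightarrow> 'b::{banach, second_countable_topology}) set set" where
  "Lp_coboundaries M p T S =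
     {Lp_class M p (\<lambda>x. (f x - koopman T f x) + (g x - koopman S g x)) | f g.
        f \<in> Lp_fun M p \<and> g \<in> Lp_fun M p}"

lemma Lp_coboundaries_subset:
  assumes "1 \<le> p" "measure_preserving M T" "measure_preserving M S"
  shows "Lp_coboundaries M p T S \<subseteq> Lp M p"
  unfolding Lp_coboundaries_def
  by (auto intro!: Lp_class_in_Lp Lp_fun_add Lp_fun_diff koopman_Lp_fun assms)

end

theory Submission
  imports Defs
begin

text \<open>Averaging the indicator of a very small set over a large square of iterates and taking the
  \<open>p\<close>-th root gives a normalized function that is almost invariant under both transformations but
  concentrated on a set of small measure, hence far from constant. So there are centred unit
  vectors \<open>h\<close> whose averages \<open>1/n \<Sum>\<Sum> U\<^sup>k V\<^sup>j h\<close> have norm about \<open>n\<close>, and a gliding hump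
  produces one centred \<open>f\<close> whose averages are unbounded. On \<open>(I-U)L\<^sub>p + (I-V)L\<^sub>p\<close> the double sums
  telescope in one direction and the averages stay bounded, so \<open>f\<close> is not in this space; by the
  mean ergodic theorem for \<open>U\<close> it is in its closure. Small sets come from the absence of atoms.\<close>

section \<open>$L_p$ preliminaries\<close>

text \<open>Sums over an n by n square see two scales: the area \<open>n^2\<close> for a nearly
  invariant function, the perimeter, of order \<open>n\<close>, for a coboundary. Division by
  \<open>n\<close> keeps coboundaries bounded and lets nearly invariant functions grow like
  \<open>n\<close>; the whole proof lives on this gap. Near invariance is easy in
  \<open>L_1\<close>: the sum \<open>F\<close> of the translates of an indicator over an N by N
  square changes only along two edges, a fraction \<open>2 / N\<close> of its integral. The p-th
  root carries this to \<open>L_p\<close>, because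
  \<open>|a^(1/p) - b^(1/p)|^p \<le> |a - b|\<close>, so one construction serves every
  \<open>p\<close>. Centring would destroy a nearly constant function. This is excluded because
  \<open>F\<close> is integer valued: its support has measure at most its integral
  \<open>N^2 P(E) \<le> 1/2\<close>, however the translates of \<open>E\<close> overlap, so no tower
  of disjoint sets has to be built. Normalization cancels the size of \<open>E\<close>, which can
  therefore be chosen after \<open>N\<close>, as small as that bound demands.\<close>

lemma Lp_norm_leI:
  assumes "0 \<le> c" "1 \<le> p" "(\<integral>x. norm (f x) powr p \<partial>M) \<le> c powr p"
  shows "Lp_norm M p f \<le> c"
proof -
  have "Lp_norm M p f \<le> (c powr p) powr (1 / p)"
    unfolding Lp_norm_def using assms by (intro powr_mono2) auto
  then show ?thesis using assms by (simp add: powr_powr)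
qed

lemma Lp_norm_cong: "(\<And>x. x \<in> space M \<Longrightarrow> f x = g x) \<Longrightarrow> Lp_norm M p f = Lp_norm M p g"
  unfolding Lp_norm_def by (metis (mono_tags, lifting) Bochner_Integration.integral_cong)

lemma Lp_fun_zero: "(\<lambda>x. 0) \<in> Lp_fun M p"
  by (simp add: Lp_fun_def)

lemma Lp_norm_zero: "Lp_norm M p (\<lambda>x. 0) = 0"
  by (simp add: Lp_norm_def)

lemma Lp_fun_scaleR:
  assumes "f \<in> Lp_fun M p"
  shows "(\<lambda>x. c *\<^sub>R f x) \<in> Lp_fun M p"
  using assms by (auto simp: Lp_fun_def powr_mult)

lemma Lp_norm_scaleR:
  fixes f :: "'a \<Rightarrow> 'b::{banach, second_countable_topology}"
  assumes "1 \<le> p"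
  shows "Lp_norm M p (\<lambda>x. c *\<^sub>R f x) = \<bar>c\<bar> * Lp_norm M p f"
  using assms by (simp add: Lp_norm_def powr_mult powr_powr)

lemma Lp_norm_uminus: "Lp_norm M p (\<lambda>x. - f x) = Lp_norm M p f"
  by (simp add: Lp_norm_def)

lemma Lp_norm_triangle_diff:
  fixes f g :: "'a \<Rightarrow> 'b::{banach, second_countable_topology}"
  assumes p: "1 \<le> p" and f: "f \<in> Lp_fun M p" and g: "g \<in> Lp_fun M p"
  shows "Lp_norm M p (\<lambda>x. f x - g x) \<le> Lp_norm M p f + Lp_norm M p g"
  using Lp_norm_triangle[OF p f Lp_fun_uminus[OF g]] by (simp add: Lp_norm_uminus)

lemma Lp_norm_reverse_triangle:
  fixes f g :: "'a \<Rightarrow> 'b::{banach, second_countable_topology}"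
  assumes p: "1 \<le> p" and f: "f \<in> Lp_fun M p" and g: "g \<in> Lp_fun M p"
  shows "Lp_norm M p f \<le> Lp_norm M p g + Lp_norm M p (\<lambda>x. f x - g x)"
  using Lp_norm_triangle[OF p g Lp_fun_diff[OF p f g]] by simp

lemma Lp_fun_sum:
  fixes f :: "'i \<Rightarrow> 'a \<Rightarrow> 'b::{banach, second_countable_topology}"
  assumes p: "1 \<le> p" and f: "\<And>i. i \<in> I \<Longrightarrow> f i \<in> Lp_fun M p"
  shows "(\<lambda>x. \<Sum>i\<in>I. f i x) \<in> Lp_fun M p"
  using f by (induction I rule: infinite_finite_induct) (auto simp: Lp_fun_zero intro: Lp_fun_add[OF p])

lemma Lp_norm_sum:
  fixes f :: "'i \<Rightarrow> 'a \<Rightarrow> 'b::{banach, second_countable_topology}"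
  assumes p: "1 \<le> p" and f: "\<And>i. i \<in> I \<Longrightarrow> f i \<in> Lp_fun M p"
  shows "Lp_norm M p (\<lambda>x. \<Sum>i\<in>I. f i x) \<le> (\<Sum>i\<in>I. Lp_norm M p (f i))"
  using f
proof (induction I rule: infinite_finite_induct)
  case (insert i I)
  then have "Lp_norm M p (\<lambda>x. f i x + (\<Sum>i\<in>I. f i x)) \<le> Lp_norm M p (f i) + Lp_norm M p (\<lambda>x. \<Sum>i\<in>I. f i x)"
    by (intro Lp_norm_triangle p Lp_fun_sum) auto
  with insert show ?case by fastforce
qed (auto simp: Lp_norm_zero)

lemma Lp_fun_of_real_iff:
  fixes f :: "'a \<Rightarrow> real"
  shows "(\<lambda>x. of_real (f x) :: complex) \<in> Lp_fun M p \<longleftrightarrow> f \<in> Lp_fun M p"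
proof
  assume *: "(\<lambda>x. of_real (f x) :: complex) \<in> Lp_fun M p"
  have "(\<lambda>x. Re (of_real (f x))) \<in> borel_measurable M"
    using Lp_funD(1)[OF *] by measurable
  with * show "f \<in> Lp_fun M p" by (auto simp: Lp_fun_def)
qed (auto simp: Lp_fun_def)

lemma Lp_norm_of_real:
  fixes f :: "'a \<Rightarrow> real"
  shows "Lp_norm M p (\<lambda>x. of_real (f x) :: complex) = Lp_norm M p f"
  by (simp add: Lp_norm_def)

context prob_space
begin

lemma Lp_fun_bounded:
  fixes f :: "'a \<Rightarrow> 'b::{banach, second_countable_topology}"
  assumes "f \<in> borel_measurable M" "\<And>x. x \<in> space M \<Longrightarrow> norm (f x) \<le> B" and p: "1 \<le> p"
  shows "f \<in> Lp_fun M p"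
proof (rule Lp_funI)
  note [measurable] = assms(1)
  show "integrable M (\<lambda>x. norm (f x) powr p)"
    using assms by (intro integrable_const_bound[of _ "B powr p"] AE_I2) (auto intro!: powr_mono2)
qed fact

lemma Lp_norm_const: "1 \<le> p \<Longrightarrow> Lp_norm M p (\<lambda>x. c) = norm c"
  by (simp add: Lp_norm_def prob_space powr_powr)

lemma integrable_Lp_fun:
  fixes f :: "'a \<Rightarrow> 'b::{banach, second_countable_topology}"
  assumes f: "f \<in> Lp_fun M p" and p: "1 \<le> p"
  shows "integrable M f"
proof (rule Bochner_Integration.integrable_bound)
  show "integrable M (\<lambda>x. 1 + norm (f x) powr p)"
    using Lp_funD[OF f] by auto
  have "norm (f x) \<le> 1 + norm (f x) powr p" for x
  proof (cases "norm (f x) \<le> 1")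
    case False
    then show ?thesis using powr_mono[OF p, of "norm (f x)"] by simp
  qed (simp add: add_increasing2)
  then show "AE x in M. norm (f x) \<le> norm (1 + norm (f x) powr p)"
    by (intro AE_I2) (smt (verit) powr_ge_zero real_norm_def)
qed (use Lp_funD[OF f] in auto)

text \<open>The optimal constant is \<open>1\<close>, but any constant serves the purpose.\<close>

lemma integral_norm_le_Lp_norm:
  fixes f :: "'a \<Rightarrow> 'b::{banach, second_countable_topology}"
  assumes f: "f \<in> Lp_fun M p" and p: "1 \<le> p"
  shows "(\<integral>x. norm (f x) \<partial>M) \<le> 2 * Lp_norm M p f"
proof (rule field_le_epsilon)
  fix e :: real assume e: "0 < e"
  \<comment> \<open>The slack keeps \<open>a\<close> positive even if \<open>f\<close> vanishes
    almost everywhere, so that \<open>t \<le> 1 + t powr p\<close> can be applied to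
    \<open>norm (f x) / a\<close>.\<close>
  define a where "a = Lp_norm M p f + e / 2"
  have a: "0 < a" using e Lp_norm_nonneg[of M p f] by (simp add: a_def add_nonneg_pos)
  have pw: "norm (f x) \<le> a * (1 + norm (f x) powr p / a powr p)" for x
  proof -
    have "t \<le> 1 + t powr p" if "0 \<le> t" for t :: real
    proof (cases "t \<le> 1")
      case False
      then show ?thesis using powr_mono[OF p, of t] by simp
    qed (simp add: add_increasing2)
    from this[of "norm (f x) / a"] a show ?thesis
      by (simp add: powr_divide pos_divide_le_eq mult.commute)
  qed
  have "(\<integral>x. norm (f x) \<partial>M) \<le> (\<integral>x. a * (1 + norm (f x) powr p / a powr p) \<partial>M)"
    using Lp_funD[OF f] integrable_Lp_fun[OF f p] by (intro integral_mono pw) auto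
  also have "\<dots> = a * (1 + Lp_norm M p f powr p / a powr p)"
    using Lp_funD[OF f] by (simp add: prob_space Lp_norm_powr[OF p])
  also have "\<dots> \<le> a * (1 + 1)"
    using a e p by (intro mult_left_mono add_left_mono) (auto simp: a_def intro!: powr_mono2)
  finally show "(\<integral>x. norm (f x) \<partial>M) \<le> 2 * Lp_norm M p f + e"
    by (simp add: a_def)
qed

lemma norm_integral_le_Lp_norm:
  fixes f :: "'a \<Rightarrow> 'b::{banach, second_countable_topology}"
  assumes f: "f \<in> Lp_fun M p" and p: "1 \<le> p"
  shows "norm (\<integral>x. f x \<partial>M) \<le> 2 * Lp_norm M p f"
  using integral_norm_bound[of M f] integral_norm_le_Lp_norm[OF assms] by linarith

text \<open>The summable rate \<open>b\<close> spares the choice of a subsequence: the increments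
  are summable in \<open>L_1\<close>, so \<open>F i\<close> converges almost everywhere, and Fatou's
  lemma passes the Cauchy bound to the limit with the same \<open>b i\<close>.\<close>

lemma Lp_fun_complete:
  fixes F :: "nat \<Rightarrow> 'a \<Rightarrow> 'b::{banach, second_countable_topology}"
  assumes p: "1 \<le> p" and F: "\<And>i. F i \<in> Lp_fun M p"
    and b: "summable b" "\<And>i m. i \<le> m \<Longrightarrow> Lp_norm M p (\<lambda>x. F m x - F i x) \<le> b i"
  shows "\<exists>f\<in>Lp_fun M p. \<forall>i. Lp_norm M p (\<lambda>x. f x - F i x) \<le> b i"
proof -
  note [measurable] = Lp_funD(1)[OF F]
  have b0: "0 \<le> b i" for i using b(2)[of i i] Lp_norm_nonneg order_trans by blast
  define G where "G i x = F (Suc i) x - F i x" for i x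
  have G: "G i \<in> Lp_fun M p" for i unfolding G_def by (intro Lp_fun_diff p F)
  have "(\<integral>\<^sup>+x. (\<Sum>i. ennreal (norm (G i x))) \<partial>M) = (\<Sum>i. \<integral>\<^sup>+x. norm (G i x) \<partial>M)"
    unfolding G_def by (intro nn_integral_suminf) measurable
  also have "\<dots> \<le> (\<Sum>i. ennreal (2 * b i))"
  proof (intro suminf_le summableI)
    fix i
    have "(\<integral>x. norm (G i x) \<partial>M) \<le> 2 * b i"
      using integral_norm_le_Lp_norm[OF G p, of i] b(2)[of i "Suc i"] by (simp add: G_def[abs_def])
    then show "(\<integral>\<^sup>+x. norm (G i x) \<partial>M) \<le> ennreal (2 * b i)"
      using integrable_Lp_fun[OF G p] by (subst nn_integral_eq_integral) (auto intro: ennreal_leI)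
  qed
  also have "\<dots> = ennreal (\<Sum>i. 2 * b i)"
    using b0 b(1) by (intro suminf_ennreal2) auto
  finally have "(\<integral>\<^sup>+x. (\<Sum>i. ennreal (norm (G i x))) \<partial>M) \<noteq> \<infinity>"
    by (auto simp: top_unique)
  then have "AE x in M. (\<Sum>i. ennreal (norm (G i x))) \<noteq> \<infinity>"
    by (intro nn_integral_PInf_AE) (auto simp: G_def)
  then have conv: "AE x in M. convergent (\<lambda>i. F i x)"
  proof eventually_elim
    case (elim x)
    then have "summable (\<lambda>i. norm (G i x))" by (intro summable_suminf_not_top) auto
    then have "summable (\<lambda>i. G i x)" by (rule summable_norm_cancel)
    then have "convergent (\<lambda>n. \<Sum>i<n. F (Suc i) x - F i x)"
      by (simp add: summable_iff_convergent G_def)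
    then have "convergent (\<lambda>n. F n x - F 0 x)" by (simp only: sum_lessThan_telescope[of "\<lambda>i. F i x"])
    then have "convergent (\<lambda>n. (F n x - F 0 x) + F 0 x)" by (intro convergent_add convergent_const)
    then show ?case by simp
  qed
  define f where "f x = lim (\<lambda>i. F i x)" for x
  have [measurable]: "f \<in> borel_measurable M"
    unfolding f_def by (intro borel_measurable_lim_metric) measurable
  have lim: "AE x in M. (\<lambda>i. F i x) \<longlonglongrightarrow> f x"
    using conv by eventually_elim (simp add: f_def convergent_LIMSEQ_iff)
  have Fatou: "(\<integral>\<^sup>+x. norm (f x - F i x) powr p \<partial>M) \<le> ennreal (b i powr p)" for i
  proof -
    have "(\<integral>\<^sup>+x. norm (f x - F i x) powr p \<partial>M) = (\<integral>\<^sup>+x. liminf (\<lambda>m. ennreal (norm (F m x - F i x) powr p)) \<partial>M)"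
    proof (rule nn_integral_cong_AE, use lim in eventually_elim)
      case (elim x)
      have "(\<lambda>m. ennreal (norm (F m x - F i x) powr p)) \<longlonglongrightarrow> ennreal (norm (f x - F i x) powr p)"
        using p by (intro tendsto_ennrealI tendsto_powr' tendsto_norm tendsto_diff elim tendsto_const) auto
      then show ?case by (rule lim_imp_Liminf[OF trivial_limit_sequentially, symmetric])
    qed
    also have "\<dots> \<le> liminf (\<lambda>m. \<integral>\<^sup>+x. ennreal (norm (F m x - F i x) powr p) \<partial>M)"
      by (intro nn_integral_liminf) measurable
    also have "\<dots> \<le> ennreal (b i powr p)"
    proof (rule Liminf_le)
      have "(\<integral>\<^sup>+x. ennreal (norm (F m x - F i x) powr p) \<partial>M) \<le> ennreal (b i powr p)" if "i \<le> m" for m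
        using Lp_funD(2)[OF Lp_fun_diff[OF p F F]] b(2)[OF that] p
        by (subst nn_integral_eq_integral)
          (auto simp flip: Lp_norm_powr[OF p] intro!: ennreal_leI powr_mono2)
      then show "\<forall>\<^sub>F m in sequentially. (\<integral>\<^sup>+x. ennreal (norm (F m x - F i x) powr p) \<partial>M) \<le> ennreal (b i powr p)"
        by (auto simp: eventually_sequentially)
    qed simp
    finally show ?thesis .
  qed
  have d: "(\<lambda>x. f x - F i x) \<in> Lp_fun M p" for i
    using Fatou[of i] by (intro Lp_funI integrableI_bounded) (auto intro: le_less_trans)
  show ?thesis
  proof (intro bexI[of _ f] allI)
    show "f \<in> Lp_fun M p" using Lp_fun_add[OF p d[of 0] F[of 0]] by simp
    show "Lp_norm M p (\<lambda>x. f x - F i x) \<le> b i" for i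
    proof (rule Lp_norm_leI[OF b0 p])
      show "(\<integral>x. norm (f x - F i x) powr p \<partial>M) \<le> b i powr p"
        using Fatou[of i] Lp_funD(2)[OF d[of i]] by (subst (asm) nn_integral_eq_integral) auto
    qed
  qed
qed

end

text \<open>Estimates concern functions, while the topology lives on equivalence classes; this
  carries an approximation argument across the quotient.\<close>

lemma Lp_closedin_limit:
  fixes f :: "'a \<Rightarrow> 'b::{banach, second_countable_topology}"
  assumes p: "1 \<le> p" and C: "closedin (Lp_topology M p) C" and f: "f \<in> Lp_fun M p"
    and *: "\<And>e. 0 < e \<Longrightarrow> \<exists>g\<in>Lp_fun M p. Lp_class M p g \<in> C \<and> Lp_norm M p (\<lambda>x. f x - g x) < e"
  shows "Lp_class M p f \<in> C"
proof (rule ccontr)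
  interpret L: Metric_space "Lp M p :: ('a \<Rightarrow> 'b) set set" "Lp_dist M p"
    by (rule Metric_space_Lp[OF p])
  assume "Lp_class M p f \<notin> C"
  then obtain r where r: "0 < r" "disjnt C (L.mball (Lp_class M p f) r)"
    using C Lp_class_in_Lp[OF f] unfolding Lp_topology_def L.closedin_metric by blast
  obtain g where g: "g \<in> Lp_fun M p" "Lp_class M p g \<in> C" "Lp_norm M p (\<lambda>x. f x - g x) < r"
    using *[OF r(1)] by blast
  then have "Lp_class M p g \<in> L.mball (Lp_class M p f) r"
    by (simp add: L.in_mball Lp_class_in_Lp f Lp_dist_class[OF p])
  with r(2) g(2) show False by (auto simp: disjnt_iff)
qed

section \<open>Birkhoff and mean ergodic theorems\<close>

lemma measure_preservingD:
  assumes "measure_preserving M T"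
  shows "T \<in> measurable M M" "distr M M T = M"
  using assms by (auto simp: measure_preserving_def)

lemma measure_preserving_comp:
  assumes "measure_preserving M T" "measure_preserving M S"
  shows "measure_preserving M (T \<circ> S)"
proof -
  note TS = measure_preservingD[OF assms(1)] measure_preservingD[OF assms(2)]
  have "distr M M (T \<circ> S) = distr (distr M M S) M T"
    by (rule distr_distr[symmetric]) (fact TS)+
  with measurable_comp[OF TS(3,1)] show ?thesis
    unfolding measure_preserving_def TS by blast
qed

lemma measure_preserving_funpow:
  assumes "measure_preserving M T"
  shows "measure_preserving M (T ^^ n)"
proof (induction n)
  case (Suc n)
  then show ?case using measure_preserving_comp[OF assms] by (simp only: funpow.simps)
qed (simp add: measure_preserving_def)

lemma measurable_comp_measure_preserving:
  assumes "measure_preserving M T" "f \<in> measurable M N"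
  shows "(\<lambda>x. f (T x)) \<in> measurable M N"
  using measurable_compose[OF measure_preservingD(1)[OF assms(1)] assms(2)] .

lemma AE_measure_preserving:
  assumes "measure_preserving M T" "AE x in M. P x"
  shows "AE x in M. P (T x)"
  using AE_koopman[OF assms(1), of P "\<lambda>_. True"] assms(2) by (simp add: koopman_def)

lemma integral_measure_preserving:
  fixes f :: "'a \<Rightarrow> 'b::{banach, second_countable_topology}"
  assumes T: "measure_preserving M T" and f: "f \<in> borel_measurable M"
  shows "(\<integral>x. f (T x) \<partial>M) = (\<integral>x. f x \<partial>M)"
  using integral_distr[OF measure_preservingD(1)[OF T] f] by (simp add: measure_preservingD(2)[OF T])

lemma integrable_measure_preserving:
  fixes f :: "'a \<Rightarrow> 'b::{banach, second_countable_topology}"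
  assumes T: "measure_preserving M T" and f: "integrable M f"
  shows "integrable M (\<lambda>x. f (T x))"
  using integrable_distr[OF measure_preservingD(1)[OF T], of f] f by (simp add: measure_preservingD(2)[OF T])

lemma Lp_fun_measure_preserving:
  assumes "measure_preserving M T" "f \<in> Lp_fun M p"
  shows "(\<lambda>x. f (T x)) \<in> Lp_fun M p"
  using koopman_Lp_fun[OF assms] by (simp add: koopman_def comp_def)

lemma Lp_norm_measure_preserving:
  assumes "measure_preserving M T" "f \<in> Lp_fun M p"
  shows "Lp_norm M p (\<lambda>x. f (T x)) = Lp_norm M p f"
  using Lp_norm_koopman[OF assms] by (simp add: koopman_def comp_def)

lemma funpow_in_space:
  assumes "measure_preserving M T" "x \<in> space M"
  shows "(T ^^ n) x \<in> space M"
  using measurable_space[OF measure_preservingD(1)[OF measure_preserving_funpow[OF assms(1)]] assms(2)] .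

section \<open>Birkhoff sums and the maximal inequality\<close>

definition birkhoff_sum :: "('a \<Rightarrow> 'a) \<Rightarrow> ('a \<Rightarrow> 'b::comm_monoid_add) \<Rightarrow> nat \<Rightarrow> 'a \<Rightarrow> 'b" where
  "birkhoff_sum T f n x = (\<Sum>k<n. f ((T ^^ k) x))"

lemma birkhoff_sum_0 [simp]: "birkhoff_sum T f 0 x = 0"
  by (simp add: birkhoff_sum_def)

lemma birkhoff_sum_Suc: "birkhoff_sum T f (Suc n) x = f x + birkhoff_sum T f n (T x)"
  by (simp only: birkhoff_sum_def sum.lessThan_Suc_shift funpow_Suc_right comp_apply funpow_0)

lemma birkhoff_sum_measurable:
  fixes f :: "'a \<Rightarrow> real"
  assumes "measure_preserving M T" "f \<in> borel_measurable M"
  shows "birkhoff_sum T f n \<in> borel_measurable M"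
  unfolding birkhoff_sum_def[abs_def]
  by (intro borel_measurable_sum measurable_comp_measure_preserving[OF measure_preserving_funpow] assms)

text \<open>This is the maximum of the Birkhoff sums of lengths \<open>0\<close> to
  \<open>n\<close>. The recursive form displays the relation to \<open>T\<close> on which the
  maximal inequality rests.\<close>

primrec birkhoff_max :: "('a \<Rightarrow> 'a) \<Rightarrow> ('a \<Rightarrow> real) \<Rightarrow> nat \<Rightarrow> 'a \<Rightarrow> real" where
  "birkhoff_max T f 0 = (\<lambda>x. 0)"
| "birkhoff_max T f (Suc n) = (\<lambda>x. max 0 (f x + birkhoff_max T f n (T x)))"

lemma birkhoff_max_nonneg: "0 \<le> birkhoff_max T f n x"
  by (cases n) auto

lemma birkhoff_max_mono: "birkhoff_max T f n x \<le> birkhoff_max T f (Suc n) x"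
proof (induction n arbitrary: x)
  case (Suc n)
  from Suc.IH[of "T x"] show ?case
    unfolding birkhoff_max.simps(2)[of T f n] birkhoff_max.simps(2)[of T f "Suc n"]
    by (intro max.mono add_left_mono order_refl) (simp only: birkhoff_max.simps(2))
qed simp

lemma birkhoff_sum_le_max: "k \<le> n \<Longrightarrow> birkhoff_sum T f k x \<le> birkhoff_max T f n x"
proof (induction n arbitrary: k x)
  case (Suc n)
  show ?case
  proof (cases k)
    case 0
    then show ?thesis by (simp only: birkhoff_sum_0 birkhoff_max_nonneg)
  next
    case (Suc l)
    with Suc.IH[of l "T x"] Suc.prems show ?thesis
      unfolding Suc birkhoff_sum_Suc birkhoff_max.simps by linarith
  qed
qed simp

lemma birkhoff_max_integrable:
  fixes f :: "'a \<Rightarrow> real"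
  assumes T: "measure_preserving M T" and f: "integrable M f"
  shows "integrable M (birkhoff_max T f n)"
proof (induction n)
  case (Suc n)
  show ?case
    using integrable_measure_preserving[OF T Suc.IH] f by simp
qed simp

text \<open>Garsia's argument: where \<open>m n\<close> is positive it equals \<open>f\<close> plus
  a maximum at \<open>T x\<close> that is at most \<open>m n (T x)\<close>, elsewhere it is
  \<open>0 \<le> m n (T x)\<close>. Integrating \<open>m n - m n o T\<close>, which has integral
  zero, gives the inequality on \<open>E n\<close>; by \<open>pos\<close> almost every point lies in
  \<open>E n\<close> for all large \<open>n\<close>, and dominated convergence removes the
  restriction.\<close>

lemma maximal_ergodic:
  fixes f :: "'a \<Rightarrow> real"
  assumes T: "measure_preserving M T" and f: "integrable M f"
    and pos: "AE x in M. \<exists>n. 0 < birkhoff_sum T f n x"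
  shows "0 \<le> (\<integral>x. f x \<partial>M)"
proof -
  define m where "m n = birkhoff_max T f (Suc n)" for n
  define E where "E n = {x. 0 < m n x}" for n
  have m: "integrable M (m n)" for n unfolding m_def by (intro birkhoff_max_integrable T f)
  have mT: "integrable M (\<lambda>x. m n (T x))" for n by (rule integrable_measure_preserving[OF T m])
  have [measurable]: "f \<in> borel_measurable M" "\<And>n. m n \<in> borel_measurable M"
    using borel_measurable_integrable[OF f] borel_measurable_integrable[OF m] by simp_all
  have *: "0 \<le> (\<integral>x. indicator (E n) x * f x \<partial>M)" for n
  proof -
    have "0 = (\<integral>x. m n x - m n (T x) \<partial>M)"
      using m mT integral_measure_preserving[OF T, of "m n"] by simp
    also have "\<dots> \<le> (\<integral>x. indicator (E n) x * f x \<partial>M)"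
    proof (intro integral_mono)
      show "integrable M (\<lambda>x. indicator (E n) x * f x)"
        by (rule Bochner_Integration.integrable_bound[OF f]) (auto simp: E_def indicator_def)
      show "m n x - m n (T x) \<le> indicator (E n) x * f x" for x
      proof (cases "0 < m n x")
        case True
        then have "m n x = f x + birkhoff_max T f n (T x)" by (auto simp: m_def max_def split: if_splits)
        also have "\<dots> \<le> f x + m n (T x)"
          using birkhoff_max_mono[of T f n "T x"] by (simp only: m_def add_left_mono)
        finally show ?thesis using True by (simp add: E_def)
      next
        case False
        moreover have "0 \<le> m n (T x)" unfolding m_def by (rule birkhoff_max_nonneg)
        ultimately show ?thesis by (simp add: E_def)
      qed
    qed (use m mT in auto)
    finally show ?thesis .
  qed
  have "(\<lambda>n. \<integral>x. indicator (E n) x * f x \<partial>M) \<longlonglongrightarrow> (\<integral>x. f x \<partial>M)"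
  proof (rule integral_dominated_convergence)
    show "integrable M (\<lambda>x. \<bar>f x\<bar>)" using f by simp
    show "AE x in M. (\<lambda>n. indicator (E n) x * f x) \<longlonglongrightarrow> f x"
      using pos
    proof eventually_elim
      case (elim x)
      then obtain k where k: "0 < birkhoff_sum T f k x" by blast
      have "indicator (E n) x * f x = f x" if "k \<le> n" for n
        using birkhoff_sum_le_max[of k "Suc n" T f x] k that by (simp add: E_def m_def)
      then show ?case
        by (intro tendsto_eventually) (auto simp: eventually_sequentially)
    qed
  qed (auto simp: E_def indicator_def)
  then show ?thesis using * by (intro LIMSEQ_le_const) auto
qed

context prob_space
begin

text \<open>Unboundedness of the Birkhoff sums of \<open>f - b\<close> is a strictly invariant property; if it held
  almost everywhere, the maximal inequality would give \<open>\<integral> f - b \<ge> 0\<close>.\<close>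

lemma AE_birkhoff_sum_bdd_above:
  assumes T: "measure_preserving M T" and erg: "ergodic M T" and f: "integrable M f"
    and b: "(\<integral>x. f x \<partial>M) < b"
  shows "AE x in M. bdd_above (range (\<lambda>n. birkhoff_sum T f n x - real n * b))"
proof -
  define u where "u x = f x - b" for x
  have u: "integrable M u" using f by (simp add: u_def[abs_def])
  note [measurable] = birkhoff_sum_measurable[OF T borel_measurable_integrable[OF u]]
  \<comment> \<open>Unboundedness is tested at integer levels, which makes \<open>B\<close>
    measurable as a countable combination.\<close>
  define B where "B = {x \<in> space M. \<forall>m::nat. \<exists>n. real m < birkhoff_sum T u n x}"
  have [measurable]: "B \<in> sets M" unfolding B_def by measurable
  have inv: "(\<forall>m::nat. \<exists>n. real m < birkhoff_sum T u n (T x)) \<longleftrightarrow> (\<forall>m::nat. \<exists>n. real m < birkhoff_sum T u n x)" for x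
  proof safe
    fix m :: nat
    assume *: "\<forall>m::nat. \<exists>n. real m < birkhoff_sum T u n (T x)"
    obtain l :: nat where "real m + \<bar>u x\<bar> \<le> real l" using real_arch_simple by blast
    moreover obtain n where "real l < birkhoff_sum T u n (T x)" using * by blast
    ultimately have "real m < birkhoff_sum T u (Suc n) x" by (simp add: birkhoff_sum_Suc)
    then show "\<exists>n. real m < birkhoff_sum T u n x" ..
  next
    fix m :: nat
    assume *: "\<forall>m::nat. \<exists>n. real m < birkhoff_sum T u n x"
    obtain l :: nat where l: "real m + \<bar>u x\<bar> \<le> real l" using real_arch_simple by blast
    obtain n where n: "real l < birkhoff_sum T u n x" using * by blast
    \<comment> \<open>The empty sum is \<open>0\<close> and does not exceed \<open>real l\<close>,
      so \<open>n\<close> is a successor.\<close>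
    then obtain k where "n = Suc k" by (cases n) auto
    with l n have "real m < birkhoff_sum T u k (T x)" by (simp add: birkhoff_sum_Suc)
    then show "\<exists>n. real m < birkhoff_sum T u n (T x)" ..
  qed
  have "T -` B \<inter> space M = B"
    using measurable_space[OF measure_preservingD(1)[OF T]] inv by (auto simp: B_def)
  then consider "prob B = 0" | "prob (space M - B) = 0"
    using erg \<open>B \<in> sets M\<close> unfolding ergodic_def by blast
  then have "prob B = 0"
  proof cases
    case 2
    then have "AE x in M. x \<in> B"
      using prob_compl[of B] by (intro AE_prob_1) simp
    then have "AE x in M. \<exists>n. 0 < birkhoff_sum T u n x"
      by eventually_elim (simp add: B_def, metis of_nat_0)
    from maximal_ergodic[OF T u this] have "b \<le> (\<integral>x. f x \<partial>M)"
      using f by (simp add: u_def prob_space)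
    with b show ?thesis by simp
  qed
  then have "AE x in M. x \<notin> B"
    by (intro AE_not_in) (auto simp: null_sets_def emeasure_eq_measure)
  then show ?thesis
    using AE_space
  proof eventually_elim
    case (elim x)
    then obtain m :: nat where "birkhoff_sum T u n x \<le> real m" for n
      by (auto simp: B_def not_less)
    moreover have "birkhoff_sum T u n x = birkhoff_sum T f n x - real n * b" for n
      by (simp add: birkhoff_sum_def u_def sum_subtractf)
    ultimately show ?case by (intro bdd_aboveI[of _ "real m"]) force
  qed
qed

text \<open>A finite supremum of \<open>S_n - n b\<close> bounds the upper limit of
  \<open>S_n / n\<close> by \<open>b\<close>; this is used for \<open>f\<close> and for
  \<open>- f\<close>, with \<open>b\<close> just above the respective mean. The slacks
  \<open>1 / Suc m\<close> keep the number of exceptional null sets countable.\<close>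

theorem birkhoff_ergodic:
  assumes T: "measure_preserving M T" and erg: "ergodic M T" and f: "integrable M f"
  shows "AE x in M. (\<lambda>n. birkhoff_sum T f n x / real n) \<longlonglongrightarrow> (\<integral>x. f x \<partial>M)"
proof -
  define c where "c = (\<integral>x. f x \<partial>M)"
  have upper: "AE x in M. bdd_above (range (\<lambda>n. birkhoff_sum T f n x - real n * (c + 1 / Suc m)))" for m :: nat
    by (intro AE_birkhoff_sum_bdd_above T erg f) (auto simp: c_def)
  have lower: "AE x in M. bdd_above (range (\<lambda>n. birkhoff_sum T (\<lambda>x. - f x) n x - real n * (- c + 1 / Suc m)))" for m :: nat
    using f by (intro AE_birkhoff_sum_bdd_above T erg) (auto simp: c_def)
  have "AE x in M. \<forall>m::nat. bdd_above (range (\<lambda>n. birkhoff_sum T f n x - real n * (c + 1 / Suc m)))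
      \<and> bdd_above (range (\<lambda>n. birkhoff_sum T (\<lambda>x. - f x) n x - real n * (- c + 1 / Suc m)))"
    using upper lower by (simp add: AE_all_countable)
  then show ?thesis
  proof eventually_elim
    case (elim x)
    show ?case unfolding c_def[symmetric]
    proof (rule LIMSEQ_I)
      fix r :: real assume r: "0 < r"
      then obtain m :: nat where m: "1 / Suc m < r / 2"
        by (metis half_gt_zero nat_approx_posE)
      obtain K where K: "birkhoff_sum T f n x - real n * (c + 1 / Suc m) \<le> K" for n
        using elim[rule_format, of m] by (auto simp: bdd_above_def)
      obtain L where L: "birkhoff_sum T (\<lambda>x. - f x) n x - real n * (- c + 1 / Suc m) \<le> L" for n
        using elim[rule_format, of m] by (auto simp: bdd_above_def)
      \<comment> \<open>From \<open>N\<close> on, the constants \<open>K\<close> and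
        \<open>L\<close> cost less than \<open>r / 2\<close> after division by \<open>n\<close>; the
        summand \<open>1\<close> forces \<open>n\<close> to be positive.\<close>
      obtain N :: nat where N: "2 * (\<bar>K\<bar> + \<bar>L\<bar> + 1) / r < real N" using reals_Archimedean2 by blast
      show "\<exists>no. \<forall>n\<ge>no. norm (birkhoff_sum T f n x / real n - c) < r"
      proof (intro exI[of _ N] allI impI)
        fix n assume "N \<le> n"
        then have "2 * (\<bar>K\<bar> + \<bar>L\<bar> + 1) / r < real n" using N by linarith
        then have n: "\<bar>K\<bar> + \<bar>L\<bar> + 1 < real n * (r / 2)" using r by (simp add: field_simps)
        then have n0: "0 < real n" by (cases "n = 0") auto
        have "birkhoff_sum T (\<lambda>x. - f x) n x = - birkhoff_sum T f n x"
          by (simp add: birkhoff_sum_def sum_negf)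
        then have *: "\<bar>birkhoff_sum T f n x - real n * c\<bar> \<le> \<bar>K\<bar> + \<bar>L\<bar> + real n * (1 / Suc m)"
          using K[of n] L[of n] unfolding distrib_left by (auto simp: abs_le_iff)
        also have "\<dots> < real n * (r / 2) + real n * (r / 2)"
          using n mult_strict_left_mono[OF m n0] by linarith
        finally have "\<bar>birkhoff_sum T f n x - real n * c\<bar> < r * real n" by (simp add: mult.commute)
        moreover have "birkhoff_sum T f n x / real n - c = (birkhoff_sum T f n x - real n * c) / real n"
          using n0 by (simp add: field_simps)
        ultimately show "norm (birkhoff_sum T f n x / real n - c) < r"
          using n0 by (simp add: pos_divide_less_eq)
      qed
    qed
  qed
qed

section \<open>Mean ergodic theorem and approximation by coboundaries\<close>

lemma mean_ergodic_bounded: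
  fixes f :: "'a \<Rightarrow> real"
  assumes T: "measure_preserving M T" and erg: "ergodic M T" and p: "1 \<le> p"
    and [measurable]: "f \<in> borel_measurable M" and B: "\<And>x. x \<in> space M \<Longrightarrow> \<bar>f x\<bar> \<le> B"
  shows "(\<lambda>n. Lp_norm M p (\<lambda>x. birkhoff_sum T f n x / real n - (\<integral>x. f x \<partial>M))) \<longlonglongrightarrow> 0"
proof -
  define c where "c = (\<integral>x. f x \<partial>M)"
  have f: "integrable M f" using B by (intro integrable_const_bound[of _ B] AE_I2) auto
  have B0: "0 \<le> B" using B not_empty by (meson abs_ge_zero ex_in_conv order_trans)
  have "\<bar>c\<bar> \<le> (\<integral>x. \<bar>f x\<bar> \<partial>M)" using integral_norm_bound[of M f] by (simp add: c_def)
  also have "\<dots> \<le> (\<integral>x. B \<partial>M)" using f B by (intro integral_mono) auto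
  finally have c: "\<bar>c\<bar> \<le> B" by (simp add: prob_space)
  note [measurable] = birkhoff_sum_measurable[OF T, of f]
  have bd: "\<bar>birkhoff_sum T f n x / real n\<bar> \<le> B" if x: "x \<in> space M" for n x
  \<comment> \<open>For \<open>n = 0\<close> the quotient is \<open>0\<close> by convention, so
    \<open>0 \<le> B\<close> is required; it holds because the space is nonempty.\<close>
  proof (cases "n = 0")
    case False
    have "\<bar>birkhoff_sum T f n x\<bar> \<le> (\<Sum>k<n. B)"
      unfolding birkhoff_sum_def by (intro sum_norm_le[where 'a = real, simplified real_norm_def] B funpow_in_space[OF T x])
    then show ?thesis using False by (simp add: field_simps)
  qed (simp add: B0)
  have "(\<lambda>n. \<integral>x. norm (birkhoff_sum T f n x / real n - c) powr p \<partial>M) \<longlonglongrightarrow> (\<integral>x. 0 \<partial>M)"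
  proof (rule integral_dominated_convergence)
    show "AE x in M. (\<lambda>n. norm (birkhoff_sum T f n x / real n - c) powr p) \<longlonglongrightarrow> 0"
      using birkhoff_ergodic[OF T erg f]
    proof eventually_elim
      case (elim x)
      then have "(\<lambda>n. norm (birkhoff_sum T f n x / real n - c)) \<longlonglongrightarrow> 0"
        by (simp only: c_def tendsto_norm_zero_iff LIM_zero_iff)
      from tendsto_powr'[OF this tendsto_const, of p] show ?case using p by simp
    qed
    show "AE x in M. norm (norm (birkhoff_sum T f n x / real n - c) powr p) \<le> (2 * B) powr p" for n
    proof (rule AE_I2)
      fix x assume "x \<in> space M"
      from bd[OF this, of n] c have "norm (birkhoff_sum T f n x / real n - c) \<le> 2 * B"
        unfolding real_norm_def by linarith
      then show "norm (norm (birkhoff_sum T f n x / real n - c) powr p) \<le> (2 * B) powr p"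
        using p by (simp add: powr_mono2)
    qed
  qed auto
  from tendsto_powr'[OF this tendsto_const, of "1 / p"] show ?thesis
    using p by (simp add: Lp_norm_def c_def)
qed

lemma Lp_bounded_approx:
  fixes f :: "'a \<Rightarrow> real"
  assumes f: "f \<in> Lp_fun M p" and p: "1 \<le> p" and e: "0 < e"
  obtains g B where "g \<in> borel_measurable M" "\<And>x. \<bar>g x\<bar> \<le> B" "Lp_norm M p (\<lambda>x. f x - g x) < e"
proof -
  note [measurable] = Lp_funD(1)[OF f]
  \<comment> \<open>Clipping at level \<open>n\<close>: the error vanishes once \<open>n\<close>
    exceeds \<open>|f x|\<close>, and \<open>|f x|\<close> dominates it throughout.\<close>
  define g where "g n x = max (- real n) (min (real n) (f x))" for n x
  have [measurable]: "g n \<in> borel_measurable M" for n unfolding g_def by measurable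
  have "(\<lambda>n. \<integral>x. norm (f x - g n x) powr p \<partial>M) \<longlonglongrightarrow> (\<integral>x. 0 \<partial>M)"
  proof (rule integral_dominated_convergence)
    show "AE x in M. (\<lambda>n. norm (f x - g n x) powr p) \<longlonglongrightarrow> 0"
    proof (rule AE_I2)
      fix x
      obtain N :: nat where N: "\<bar>f x\<bar> \<le> real N" using real_arch_simple by blast
      have "norm (f x - g n x) powr p = 0" if "N \<le> n" for n
      proof -
        have "\<bar>f x\<bar> \<le> real n" using N that by linarith
        then show ?thesis by (auto simp: g_def)
      qed
      then show "(\<lambda>n. norm (f x - g n x) powr p) \<longlonglongrightarrow> 0"
        by (intro tendsto_eventually) (auto simp: eventually_sequentially)
    qed
    show "AE x in M. norm (norm (f x - g n x) powr p) \<le> norm (f x) powr p" for n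
      using p by (intro AE_I2) (auto simp: g_def intro!: powr_mono2)
  qed (use Lp_funD(2)[OF f] in auto)
  from tendsto_powr'[OF this tendsto_const, of "1 / p"]
  have "(\<lambda>n. Lp_norm M p (\<lambda>x. f x - g n x)) \<longlonglongrightarrow> 0"
    using p by (simp add: Lp_norm_def)
  then obtain n where "Lp_norm M p (\<lambda>x. f x - g n x) < e"
    using order_tendstoD(2)[OF _ e] eventually_happens'[OF sequentially_bot] by blast
  moreover have "\<bar>g n x\<bar> \<le> real n" for x by (auto simp: g_def)
  ultimately show thesis by (intro that[of "g n" "real n"]) auto
qed

lemma Lp_norm_birkhoff_average_le:
  fixes f :: "'a \<Rightarrow> real"
  assumes T: "measure_preserving M T" and f: "f \<in> Lp_fun M p" and p: "1 \<le> p"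
  shows "(\<lambda>x. birkhoff_sum T f n x / real n) \<in> Lp_fun M p"
    and "Lp_norm M p (\<lambda>x. birkhoff_sum T f n x / real n) \<le> Lp_norm M p f"
proof -
  note fT = Lp_fun_measure_preserving[OF measure_preserving_funpow[OF T] f]
  have eq: "(\<lambda>x. birkhoff_sum T f n x / real n) = (\<lambda>x. (1 / real n) *\<^sub>R (\<Sum>k<n. f ((T ^^ k) x)))"
    by (simp add: birkhoff_sum_def)
  show "(\<lambda>x. birkhoff_sum T f n x / real n) \<in> Lp_fun M p"
    unfolding eq by (intro Lp_fun_scaleR Lp_fun_sum p fT)
  have "Lp_norm M p (\<lambda>x. \<Sum>k<n. f ((T ^^ k) x)) \<le> (\<Sum>k<n. Lp_norm M p f)"
    using Lp_norm_sum[OF p, of "{..<n}" "\<lambda>k x. f ((T ^^ k) x)" M] fT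
    by (simp add: Lp_norm_measure_preserving[OF measure_preserving_funpow[OF T] f])
  then show "Lp_norm M p (\<lambda>x. birkhoff_sum T f n x / real n) \<le> Lp_norm M p f"
    unfolding eq Lp_norm_scaleR[OF p] by (cases "n = 0") (auto simp: field_simps)
qed

text \<open>Averaging is a contraction of \<open>L_p\<close>, so the bounded case extends by
  density. The bounded approximant may have a nonzero mean \<open>c\<close>, which is controlled
  through the mean of \<open>f - g\<close>.\<close>

lemma mean_ergodic:
  fixes f :: "'a \<Rightarrow> real"
  assumes T: "measure_preserving M T" and erg: "ergodic M T" and p: "1 \<le> p"
    and f: "f \<in> Lp_fun M p" and f0: "(\<integral>x. f x \<partial>M) = 0" and e: "0 < e"
  obtains n where "0 < n" "Lp_norm M p (\<lambda>x. birkhoff_sum T f n x / real n) < e"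
proof -
  \<comment> \<open>Error budget: \<open>e / 4\<close> for \<open>f - g\<close>,
    \<open>e / 4\<close> for the averages of \<open>g\<close>, and \<open>e / 2\<close> for the
    constant \<open>c\<close>, owing to the factor \<open>2\<close> in
    \<open>norm_integral_le_Lp_norm\<close>.\<close>
  obtain g B where g [measurable]: "g \<in> borel_measurable M" and B: "\<And>x. \<bar>g x\<bar> \<le> B"
    and fg: "Lp_norm M p (\<lambda>x. f x - g x) < e / 4"
    using Lp_bounded_approx[OF f p, of "e / 4"] e by auto
  define c where "c = (\<integral>x. g x \<partial>M)"
  have gp: "g \<in> Lp_fun M p" using B by (intro Lp_fun_bounded[of _ B] p) auto
  have d: "(\<lambda>x. f x - g x) \<in> Lp_fun M p" by (intro Lp_fun_diff p f gp)
  have "c = - (\<integral>x. f x - g x \<partial>M)"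
    using integrable_Lp_fun[OF f p] integrable_Lp_fun[OF gp p] f0 by (simp add: c_def)
  then have c: "\<bar>c\<bar> \<le> 2 * Lp_norm M p (\<lambda>x. f x - g x)"
    using norm_integral_le_Lp_norm[OF d p] by simp
  have "\<forall>\<^sub>F n in sequentially. Lp_norm M p (\<lambda>x. birkhoff_sum T g n x / real n - c) < e / 4"
    using mean_ergodic_bounded[OF T erg p g B] e unfolding c_def by (intro order_tendstoD(2)) auto
  then have "\<forall>\<^sub>F n in sequentially. 0 < n \<and> Lp_norm M p (\<lambda>x. birkhoff_sum T g n x / real n - c) < e / 4"
    using eventually_gt_at_top[of 0] by eventually_elim auto
  then obtain n where n: "0 < n" "Lp_norm M p (\<lambda>x. birkhoff_sum T g n x / real n - c) < e / 4"
    using eventually_happens'[OF sequentially_bot] by blast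
  let ?A = "\<lambda>h x. birkhoff_sum T h n x / real n"
  have cp: "(\<lambda>x. c) \<in> Lp_fun M p" by (intro Lp_fun_bounded[of _ "\<bar>c\<bar>"] p) auto
  note Ag = Lp_norm_birkhoff_average_le(1)[OF T gp p, of n]
  have "?A f = (\<lambda>x. ?A (\<lambda>x. f x - g x) x + ((?A g x - c) + c))"
    by (auto simp: birkhoff_sum_def sum_subtractf diff_divide_distrib)
  then have "Lp_norm M p (?A f) \<le> Lp_norm M p (?A (\<lambda>x. f x - g x)) + (Lp_norm M p (\<lambda>x. ?A g x - c) + Lp_norm M p (\<lambda>x. c))"
    using Lp_norm_triangle[OF p Lp_norm_birkhoff_average_le(1)[OF T d p, of n]
        Lp_fun_add[OF p Lp_fun_diff[OF p Ag cp] cp]]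
      Lp_norm_triangle[OF p Lp_fun_diff[OF p Ag cp] cp] by simp
  also have "\<dots> < e"
    using Lp_norm_birkhoff_average_le(2)[OF T d p, of n] n(2) c fg Lp_norm_const[OF p, of c] by simp
  finally show thesis using n(1) that by blast
qed

text \<open>Subtracting from \<open>f\<close> its \<open>n\<close>-th average leaves the mean over
  \<open>k < n\<close> of \<open>f - f o T^k\<close>, and each of these is the coboundary of a
  partial orbit sum. So \<open>f\<close> is an exact coboundary up to an average that is
  small.\<close>

lemma coboundary_approx:
  fixes f :: "'a \<Rightarrow> real"
  assumes T: "measure_preserving M T" and erg: "ergodic M T" and p: "1 \<le> p"
    and f: "f \<in> Lp_fun M p" and f0: "(\<integral>x. f x \<partial>M) = 0" and e: "0 < e"
  obtains u where "u \<in> Lp_fun M p" "Lp_norm M p (\<lambda>x. f x - (u x - u (T x))) < e"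
proof -
  obtain n where n: "0 < n" "Lp_norm M p (\<lambda>x. birkhoff_sum T f n x / real n) < e"
    using mean_ergodic[OF T erg p f f0 e] .
  define u where "u x = (1 / real n) *\<^sub>R (\<Sum>k<n. \<Sum>i<k. f ((T ^^ i) x))" for x
  have "u \<in> Lp_fun M p"
    unfolding u_def[abs_def]
    by (intro Lp_fun_scaleR Lp_fun_sum p Lp_fun_measure_preserving[OF measure_preserving_funpow[OF T] f])
  moreover have "f x - (u x - u (T x)) = birkhoff_sum T f n x / real n" for x
  proof -
    have tel: "(\<Sum>i<k. f ((T ^^ i) x)) - (\<Sum>i<k. f ((T ^^ i) (T x))) = f x - f ((T ^^ k) x)" for k
      by (induction k) (auto simp: funpow_swap1)
    have "u x - u (T x) = (1 / real n) * (\<Sum>k<n. f x - f ((T ^^ k) x))"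
      by (simp add: u_def flip: tel) (simp add: sum_subtractf diff_divide_distrib)
    then show ?thesis using n(1) by (simp add: sum_subtractf birkhoff_sum_def field_simps)
  qed
  ultimately show thesis using n(2) by (intro that[of u]) simp_all
qed

end

section \<open>Almost invariant functions\<close>

text \<open>Divided by \<open>u powr p\<close>, this is \<open>t powr p \<le> t\<close> on
  \<open>[0,1]\<close>, for \<open>t = v / u\<close> and its complement.\<close>

lemma powr_superadditive:
  fixes u v p :: real
  assumes p: "1 \<le> p" and v: "0 \<le> v" "v \<le> u"
  shows "(u - v) powr p + v powr p \<le> u powr p"
proof (cases "u = 0")
  case False
  with v have u: "0 < u" by simp
  have *: "t powr p \<le> t" if "0 \<le> t" "t \<le> 1" for t :: real
    using powr_mono'[OF p that] that by simp
  have "(u - v) powr p + v powr p = u powr p * (((u - v) / u) powr p + (v / u) powr p)"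
    using u v by (simp add: powr_divide distrib_left)
  also have "\<dots> \<le> u powr p * ((u - v) / u + v / u)"
    using u v by (intro mult_left_mono add_mono *) (auto simp: field_simps)
  also have "\<dots> = u powr p"
    using u by (simp flip: add_divide_distrib)
  finally show ?thesis .
qed (use v in auto)

text \<open>Hoelder continuity of the p-th root with constant 1. It turns an \<open>L_1\<close>
  estimate for a function into an \<open>L_p\<close> estimate for its p-th root.\<close>

lemma powr_inverse_diff_le:
  fixes a b p :: real
  assumes p: "1 \<le> p" and "0 \<le> a" "0 \<le> b"
  shows "\<bar>a powr (1 / p) - b powr (1 / p)\<bar> powr p \<le> \<bar>a - b\<bar>"
proof -
  have *: "(x powr (1 / p) - y powr (1 / p)) powr p \<le> x - y" if "0 \<le> y" "y \<le> x" for x y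
    using powr_superadditive[OF p, of "y powr (1 / p)" "x powr (1 / p)"] that p
    by (simp add: powr_powr powr_mono2)
  show ?thesis
  proof (cases "b \<le> a")
    case True
    then show ?thesis using *[of b a] assms p by (simp add: powr_mono2)
  next
    case False
    then show ?thesis using *[of a b] assms p powr_mono2[of "1 / p" a b] by (simp add: abs_if)
  qed
qed

lemma funpow_commute_on_space:
  assumes T: "measure_preserving M T" and S: "measure_preserving M S"
    and comm: "\<And>x. x \<in> space M \<Longrightarrow> T (S x) = S (T x)" and x: "x \<in> space M"
  shows "(T ^^ k) (S x) = S ((T ^^ k) x)"
  by (induction k) (simp_all add: comm funpow_in_space[OF T x])

context prob_space
begin

text \<open>A set that is not an atom splits into two parts of positive measure, and one of them has
  at most half of it; iterate.\<close>

lemma non_atomic_small_set: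
  assumes "non_atomic M" and d: "0 < d"
  obtains E where "E \<in> sets M" "0 < prob E" "prob E \<le> d"
proof -
  have "\<exists>E\<in>sets M. 0 < prob E \<and> prob E \<le> (1 / 2) ^ n" for n
  proof (induction n)
    case 0
    show ?case by (intro bexI[of _ "space M"]) (auto simp: prob_space)
  next
    case (Suc n)
    then obtain E where E: "E \<in> sets M" "0 < prob E" "prob E \<le> (1 / 2) ^ n" by blast
    then obtain B where B: "B \<in> sets M" "B \<subseteq> E" "0 < prob B" "0 < prob (E - B)"
      using assms(1) unfolding non_atomic_def
      by (auto simp: emeasure_eq_measure zero_less_measure_iff ennreal_eq_0_iff not_le dest!: bspec[of _ _ E])
    have "prob (E - B) = prob E - prob B" using E B by (intro finite_measure_Diff) auto
    then have "prob B \<le> (1 / 2) ^ Suc n \<or> prob (E - B) \<le> (1 / 2) ^ Suc n" using E by auto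
    then show ?case using B E by (meson sets.Diff)
  qed
  moreover obtain n where "(1 / 2 :: real) ^ n < d"
    using real_arch_pow_inv[OF d, of "1 / 2"] by auto
  ultimately show thesis using that by (metis less_le_not_le order.trans nle_le)
qed

lemma almost_invariant_function:
  fixes \<epsilon> :: real
  assumes na: "non_atomic M" and T: "measure_preserving M T" and S: "measure_preserving M S"
    and comm: "\<And>x. x \<in> space M \<Longrightarrow> T (S x) = S (T x)"
    and p: "1 \<le> p" and \<epsilon>: "0 < \<epsilon>"
  obtains h :: "'a \<Rightarrow> real" where "h \<in> Lp_fun M p" "(\<integral>x. h x \<partial>M) = 0" "Lp_norm M p h = 1"
    "Lp_norm M p (\<lambda>x. h (T x) - h x) \<le> \<epsilon>" "Lp_norm M p (\<lambda>x. h (S x) - h x) \<le> \<epsilon>"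
proof -
  \<comment> \<open>Chosen so that \<open>3 * (2 / N) powr (1 / p) \<le> \<epsilon>\<close>:
    \<open>2 / N\<close> is the ratio of edges to area, and \<open>3\<close> is the loss from
    centring.\<close>
  obtain N :: nat where N: "2 / (\<epsilon> / 3) powr p < real N" using reals_Archimedean2 by blast
  have "0 < 2 / (\<epsilon> / 3) powr p" using \<epsilon> by simp
  with N have N0: "0 < real N" by linarith
  have "0 < 1 / (2 * real N ^ 2)" using N0 by simp
  \<comment> \<open>The bound makes the integral \<open>s\<close> of \<open>F\<close> at most
    \<open>1 / 2\<close>, so that \<open>F\<close> will vanish on at least half of the
    space.\<close>
  then obtain E where E [measurable]: "E \<in> sets M" and E0: "0 < prob E" and E1: "prob E \<le> 1 / (2 * real N ^ 2)"
    using non_atomic_small_set[OF na] by blast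
  define s where "s = real N ^ 2 * prob E"
  have s: "0 < s" "s \<le> 1 / 2" using E0 E1 N0 by (auto simp: s_def field_simps)
  define I :: "nat \<Rightarrow> nat \<Rightarrow> 'a \<Rightarrow> real" where "I j k x = indicator E ((S ^^ j) ((T ^^ k) x))" for j k x
  have I_mp: "measure_preserving M (\<lambda>x. (S ^^ j) ((T ^^ k) x))" for j k
    using measure_preserving_comp[OF measure_preserving_funpow[OF S] measure_preserving_funpow[OF T]]
    by (simp add: comp_def)
  have ind: "integrable M (indicator A :: 'a \<Rightarrow> real)" if [measurable]: "A \<in> sets M" for A
    by (intro integrable_const_bound[of _ 1]) auto
  have I: "integrable M (I j k)" "(\<integral>x. I j k x \<partial>M) = prob E" for j k
    unfolding I_def
    using integrable_measure_preserving[OF I_mp ind[OF E]]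
      integral_measure_preserving[OF I_mp, of "indicator E :: 'a \<Rightarrow> real"] by simp_all
  have I01: "0 \<le> I j k x" for j k x by (simp add: I_def)
  define F where "F x = (\<Sum>k<N. \<Sum>j<N. I j k x)" for x
  have F: "integrable M F" unfolding F_def[abs_def] using I by simp
  have intF: "(\<integral>x. F x \<partial>M) = s"
    using I by (simp add: F_def[abs_def] s_def power2_eq_square)
  have F0: "0 \<le> F x" for x unfolding F_def using I01 by (intro sum_nonneg)
  have [measurable]: "F \<in> borel_measurable M" using F by simp
  \<comment> \<open>\<open>F\<close> counts the visits of a square of iterates to \<open>E\<close>,
    hence is integer valued; being at least \<open>1\<close> on its support, it bounds the measure
    of the support by its integral.\<close>
  have F1: "1 \<le> F x" if "F x \<noteq> 0" for x
  proof -
    have "F x = real (\<Sum>k<N. \<Sum>j<N. if (S ^^ j) ((T ^^ k) x) \<in> E then 1 else 0)"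
      unfolding F_def I_def of_nat_sum by (intro sum.cong refl) auto
    then obtain m where "F x = real m" ..
    with that show ?thesis by simp
  qed
  \<comment> \<open>Summation over \<open>k\<close> telescopes and leaves two edges of the square,
    each of integral \<open>N * prob E\<close>.\<close>
  have FT: "(\<integral>x. \<bar>F (T x) - F x\<bar> \<partial>M) \<le> 2 * real N * prob E"
  proof -
    have "\<bar>F (T x) - F x\<bar> \<le> (\<Sum>j<N. I j N x) + (\<Sum>j<N. I j 0 x)" for x
    proof -
      have "F (T x) - F x = (\<Sum>k<N. (\<Sum>j<N. I j (Suc k) x) - (\<Sum>j<N. I j k x))"
        by (simp add: F_def I_def sum_subtractf funpow_swap1)
      also have "\<dots> = (\<Sum>j<N. I j N x) - (\<Sum>j<N. I j 0 x)"
        by (rule sum_lessThan_telescope)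
      finally show ?thesis
        using sum_nonneg[of "{..<N}" "\<lambda>j. I j N x"] sum_nonneg[of "{..<N}" "\<lambda>j. I j 0 x"] I01 by simp
    qed
    then have "(\<integral>x. \<bar>F (T x) - F x\<bar> \<partial>M) \<le> (\<integral>x. (\<Sum>j<N. I j N x) + (\<Sum>j<N. I j 0 x) \<partial>M)"
      using I F integrable_measure_preserving[OF T F] by (intro integral_mono) auto
    then show ?thesis using I by simp
  qed
  have FS: "(\<integral>x. \<bar>F (S x) - F x\<bar> \<partial>M) \<le> 2 * real N * prob E"
  proof -
    have "\<bar>F (S x) - F x\<bar> \<le> (\<Sum>k<N. I N k x) + (\<Sum>k<N. I 0 k x)" if x: "x \<in> space M" for x
    proof -
      have "F (S x) - F x = (\<Sum>k<N. \<Sum>j<N. I (Suc j) k x - I j k x)"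
        by (simp add: F_def I_def sum_subtractf funpow_commute_on_space[OF T S comm x] funpow_swap1)
      also have "\<dots> = (\<Sum>k<N. I N k x - I 0 k x)"
        by (intro sum.cong refl sum_lessThan_telescope)
      finally show ?thesis
        using sum_nonneg[of "{..<N}" "\<lambda>k. I N k x"] sum_nonneg[of "{..<N}" "\<lambda>k. I 0 k x"] I01
        by (simp add: sum_subtractf)
    qed
    then have "(\<integral>x. \<bar>F (S x) - F x\<bar> \<partial>M) \<le> (\<integral>x. (\<Sum>k<N. I N k x) + (\<Sum>k<N. I 0 k x) \<partial>M)"
      using I F integrable_measure_preserving[OF S F] by (intro integral_mono) auto
    then show ?thesis using I by simp
  qed
  define g where "g x = F x powr (1 / p)" for x
  have [measurable]: "g \<in> borel_measurable M" unfolding g_def by measurable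
  have gp: "norm (g x) powr p = F x" for x using p F0 by (simp add: g_def powr_powr)
  have g: "g \<in> Lp_fun M p" by (rule Lp_funI, measurable) (unfold gp, rule F)
  have g_norm: "Lp_norm M p g = s powr (1 / p)" unfolding Lp_norm_def gp intF ..
  have diff: "Lp_norm M p (\<lambda>x. g (R x) - g x) \<le> (2 * real N * prob E) powr (1 / p)"
    if R: "measure_preserving M R" and FR: "(\<integral>x. \<bar>F (R x) - F x\<bar> \<partial>M) \<le> 2 * real N * prob E" for R
  proof (rule Lp_norm_leI[OF _ p])
    have "(\<integral>x. norm (g (R x) - g x) powr p \<partial>M) \<le> (\<integral>x. \<bar>F (R x) - F x\<bar> \<partial>M)"
    proof (rule integral_mono)
      show "integrable M (\<lambda>x. norm (g (R x) - g x) powr p)"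
        by (intro Lp_funD(2) Lp_fun_diff[OF p Lp_fun_measure_preserving[OF R g] g])
      show "integrable M (\<lambda>x. \<bar>F (R x) - F x\<bar>)"
        using F integrable_measure_preserving[OF R F] by simp
      show "norm (g (R x) - g x) powr p \<le> \<bar>F (R x) - F x\<bar>" for x
        using powr_inverse_diff_le[OF p F0 F0] by (simp add: g_def)
    qed
    with FR show "(\<integral>x. norm (g (R x) - g x) powr p \<partial>M) \<le> ((2 * real N * prob E) powr (1 / p)) powr p"
      using p by (simp add: powr_powr)
  qed simp
  define c where "c = (\<integral>x. g x \<partial>M)"
  have c0: "0 \<le> c" unfolding c_def by (intro integral_nonneg_AE) (simp add: g_def)
  have cp: "(\<lambda>x. c) \<in> Lp_fun M p" using c0 by (intro Lp_fun_bounded[of _ c] p) auto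
  define a where "a = Lp_norm M p (\<lambda>x. g x - c)"
  have gc: "(\<lambda>x. g x - c) \<in> Lp_fun M p" by (intro Lp_fun_diff p g cp)
  \<comment> \<open>Where \<open>F\<close> vanishes, on at least half of the space,
    \<open>g - c\<close> equals \<open>- c\<close>; so \<open>a powr p\<close> is at least
    \<open>c powr p / 2\<close>, hence at least \<open>(c / 2) powr p\<close>.\<close>
  have "c / 2 \<le> a"
  proof (rule ccontr)
    assume "\<not> c / 2 \<le> a"
    then have "a powr p < (c / 2) powr p" using p by (intro powr_less_mono2) (auto simp: a_def)
    also have "\<dots> \<le> c powr p * (1 / 2)"
      using p powr_mono'[OF p, of "1 / 2"] by (simp add: powr_divide divide_simps mult_left_mono)
    also have "\<dots> \<le> c powr p * prob {x \<in> space M. F x = 0}"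
    proof (intro mult_left_mono)
      have "prob {x \<in> space M. F x \<noteq> 0} = (\<integral>x. indicator {x \<in> space M. F x \<noteq> 0} x \<partial>M)"
        by simp
      also have "\<dots> \<le> (\<integral>x. F x \<partial>M)"
        using F0 F1 by (intro integral_mono F ind) (measurable, simp add: indicator_def)
      finally have "prob {x \<in> space M. F x \<noteq> 0} \<le> 1 / 2" using s intF by simp
      moreover have "prob {x \<in> space M. \<not> F x \<noteq> 0} = 1 - prob {x \<in> space M. F x \<noteq> 0}"
        by (rule prob_neg) measurable
      ultimately show "1 / 2 \<le> prob {x \<in> space M. F x = 0}" by simp
    qed simp
    also have "\<dots> = (\<integral>x. c powr p * indicator {x \<in> space M. F x = 0} x \<partial>M)"
      by simp
    also have "\<dots> \<le> (\<integral>x. norm (g x - c) powr p \<partial>M)"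
      using Lp_funD(2)[OF gc] c0
      by (intro integral_mono integrable_mult_right ind) (measurable, simp, simp add: indicator_def g_def)
    also have "\<dots> = a powr p" unfolding a_def Lp_norm_powr[OF p] ..
    finally show False by simp
  qed
  \<comment> \<open>With \<open>c \<le> 2 * a\<close>, centring costs the norm of \<open>g\<close>
    at most a factor \<open>3\<close>.\<close>
  moreover have "s powr (1 / p) \<le> a + c"
    using Lp_norm_triangle[OF p gc cp] Lp_norm_const[OF p, of c] c0 by (simp add: g_norm a_def)
  ultimately have a: "s powr (1 / p) \<le> 3 * a" by linarith
  have a0: "0 < a" using a s by (smt (verit) powr_gt_zero)
  define h where "h x = (1 / a) *\<^sub>R (g x - c)" for x
  have close: "Lp_norm M p (\<lambda>x. h (R x) - h x) \<le> \<epsilon>"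
    if R: "measure_preserving M R" and FR: "(\<integral>x. \<bar>F (R x) - F x\<bar> \<partial>M) \<le> 2 * real N * prob E" for R
  proof -
    have "(\<lambda>x. h (R x) - h x) = (\<lambda>x. (1 / a) *\<^sub>R (g (R x) - g x))"
      by (simp add: h_def fun_eq_iff diff_divide_distrib)
    then have "Lp_norm M p (\<lambda>x. h (R x) - h x) = 1 / a * Lp_norm M p (\<lambda>x. g (R x) - g x)"
      using a0 by (simp only: Lp_norm_scaleR[OF p]) simp
    also have "\<dots> \<le> 1 / a * (2 * real N * prob E) powr (1 / p)"
      using a0 diff[OF R FR] by (intro mult_left_mono) auto
    \<comment> \<open>Writing the edges as the fraction \<open>2 / N\<close> of the area
      \<open>s\<close> lets \<open>s powr (1 / p) \<le> 3 * a\<close> cancel the size of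
      \<open>E\<close>.\<close>
    also have "2 * real N * prob E = (2 / real N) * s"
      using N0 by (simp add: s_def power2_eq_square)
    also have "((2 / real N) * s) powr (1 / p) = (2 / real N) powr (1 / p) * s powr (1 / p)"
      by (rule powr_mult)
    also have "1 / a * \<dots> \<le> 1 / a * ((2 / real N) powr (1 / p) * (3 * a))"
      using a a0 by (intro mult_left_mono) auto
    also have "\<dots> = 3 * (2 / real N) powr (1 / p)" using a0 by simp
    also have "\<dots> \<le> 3 * ((\<epsilon> / 3) powr p) powr (1 / p)"
    proof (intro mult_left_mono powr_mono2)
      show "2 / real N \<le> (\<epsilon> / 3) powr p"
        using N N0 \<epsilon> by (simp add: field_simps)
    qed (use p N0 in auto)
    also have "\<dots> = \<epsilon>" using p \<epsilon> by (simp add: powr_powr)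
    finally show ?thesis .
  qed
  show thesis
  proof
    show "h \<in> Lp_fun M p" unfolding h_def[abs_def] by (rule Lp_fun_scaleR[OF gc])
    show "(\<integral>x. h x \<partial>M) = 0"
      using integrable_Lp_fun[OF g p] by (simp add: h_def c_def prob_space)
    show "Lp_norm M p h = 1"
      using a0 unfolding h_def[abs_def] Lp_norm_scaleR[OF p] a_def[symmetric] by simp
  qed (use close[OF T FT] close[OF S FS] in auto)
qed

end

section \<open>Averages over squares\<close>

definition square_average :: "('a \<Rightarrow> 'a) \<Rightarrow> ('a \<Rightarrow> 'a) \<Rightarrow> nat \<Rightarrow> ('a \<Rightarrow> 'b::real_vector) \<Rightarrow> 'a \<Rightarrow> 'b" where
  "square_average T S n f x = (1 / real n) *\<^sub>R (\<Sum>k<n. \<Sum>j<n. f ((S ^^ j) ((T ^^ k) x)))"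

text \<open>As in the theorem, the normalization is by \<open>n\<close> although there are \<open>n\<^sup>2\<close> summands, so
  the operator norm of \<^term>\<open>square_average T S n\<close> is bounded by \<open>n\<close> only.\<close>

lemma square_average_Lp:
  fixes f :: "'a \<Rightarrow> 'b::{banach, second_countable_topology}"
  assumes T: "measure_preserving M T" and S: "measure_preserving M S" and p: "1 \<le> p" and f: "f \<in> Lp_fun M p"
  shows "square_average T S n f \<in> Lp_fun M p"
    and "Lp_norm M p (square_average T S n f) \<le> real n * Lp_norm M p f"
proof -
  have TS: "measure_preserving M (\<lambda>x. (S ^^ j) ((T ^^ k) x))" for j k
    using measure_preserving_comp[OF measure_preserving_funpow[OF S] measure_preserving_funpow[OF T]]
    by (simp add: comp_def)
  note fTS = Lp_fun_measure_preserving[OF TS f]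
  show "square_average T S n f \<in> Lp_fun M p"
    unfolding square_average_def[abs_def] by (intro Lp_fun_scaleR Lp_fun_sum p fTS)
  have "Lp_norm M p (\<lambda>x. \<Sum>k<n. \<Sum>j<n. f ((S ^^ j) ((T ^^ k) x)))
      \<le> (\<Sum>k<n. Lp_norm M p (\<lambda>x. \<Sum>j<n. f ((S ^^ j) ((T ^^ k) x))))"
    by (intro Lp_norm_sum Lp_fun_sum p fTS)
  also have "\<dots> \<le> (\<Sum>k<n. \<Sum>j<n. Lp_norm M p (\<lambda>x. f ((S ^^ j) ((T ^^ k) x))))"
    by (intro sum_mono Lp_norm_sum p fTS)
  also have "\<dots> = real n * real n * Lp_norm M p f"
    by (simp add: Lp_norm_measure_preserving[OF TS f])
  finally show "Lp_norm M p (square_average T S n f) \<le> real n * Lp_norm M p f"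
    unfolding square_average_def[abs_def] Lp_norm_scaleR[OF p]
    by (cases "n = 0") (auto simp: field_simps)
qed

lemma square_average_add:
  "square_average T S n (\<lambda>x. f x + g x) = (\<lambda>x. square_average T S n f x + square_average T S n g x)"
  by (simp add: square_average_def sum.distrib scaleR_right_distrib fun_eq_iff)

lemma square_average_diff:
  "square_average T S n (\<lambda>x. f x - g x) = (\<lambda>x. square_average T S n f x - square_average T S n g x)"
  by (simp add: square_average_def sum_subtractf scaleR_right_diff_distrib fun_eq_iff)

lemma square_average_scaleR:
  "square_average T S n (\<lambda>x. c *\<^sub>R f x) = (\<lambda>x. c *\<^sub>R square_average T S n f x)"
  by (simp add: square_average_def fun_eq_iff flip: scaleR_sum_right)

text \<open>Each of the \<open>k\<close> increments along the orbit is the first one composed with a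
  power of \<open>T\<close>, hence has the same norm.\<close>

lemma Lp_norm_funpow_diff_le:
  fixes h :: "'a \<Rightarrow> 'b::{banach, second_countable_topology}"
  assumes T: "measure_preserving M T" and p: "1 \<le> p" and h: "h \<in> Lp_fun M p"
    and \<epsilon>: "Lp_norm M p (\<lambda>x. h (T x) - h x) \<le> \<epsilon>"
  shows "Lp_norm M p (\<lambda>x. h ((T ^^ k) x) - h x) \<le> real k * \<epsilon>"
proof (induction k)
  case (Suc k)
  note hT = Lp_fun_measure_preserving[OF T h]
  note Tk = measure_preserving_funpow[OF T, of k]
  note d = Lp_fun_diff[OF p hT h]
  have "Lp_norm M p (\<lambda>x. (h (T ((T ^^ k) x)) - h ((T ^^ k) x)) + (h ((T ^^ k) x) - h x))
      \<le> Lp_norm M p (\<lambda>x. h (T ((T ^^ k) x)) - h ((T ^^ k) x)) + Lp_norm M p (\<lambda>x. h ((T ^^ k) x) - h x)"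
    by (intro Lp_norm_triangle p Lp_fun_measure_preserving[OF Tk d] Lp_fun_diff Lp_fun_measure_preserving[OF Tk h] h)
  also have "Lp_norm M p (\<lambda>x. h (T ((T ^^ k) x)) - h ((T ^^ k) x)) = Lp_norm M p (\<lambda>x. h (T x) - h x)"
    by (rule Lp_norm_measure_preserving[OF Tk d])
  finally show ?case using Suc.IH \<epsilon> by (simp add: algebra_simps)
qed (simp add: Lp_norm_zero)

text \<open>Inside the square every translate of \<open>h\<close> is within
  \<open>2 * n * \<epsilon>\<close> of \<open>h\<close>, so \<open>n^2\<close> of them divided by
  \<open>n\<close> give \<open>n\<close> times \<open>h\<close>, up to \<open>n\<close> times that
  error.\<close>

lemma square_average_almost_invariant:
  fixes h :: "'a \<Rightarrow> 'b::{banach, second_countable_topology}"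
  assumes T: "measure_preserving M T" and S: "measure_preserving M S" and p: "1 \<le> p" and h: "h \<in> Lp_fun M p"
    and hT: "Lp_norm M p (\<lambda>x. h (T x) - h x) \<le> \<epsilon>" and hS: "Lp_norm M p (\<lambda>x. h (S x) - h x) \<le> \<epsilon>"
  shows "real n * (Lp_norm M p h - 2 * real n * \<epsilon>) \<le> Lp_norm M p (square_average T S n h)"
proof (cases "n = 0")
  case False
  have \<epsilon>: "0 \<le> \<epsilon>" using hT Lp_norm_nonneg order_trans by blast
  have TS: "measure_preserving M (\<lambda>x. (S ^^ j) ((T ^^ k) x))" for j k
    using measure_preserving_comp[OF measure_preserving_funpow[OF S] measure_preserving_funpow[OF T]]
    by (simp add: comp_def)
  note hTS = Lp_fun_measure_preserving[OF TS h]
  have close: "Lp_norm M p (\<lambda>x. h ((S ^^ j) ((T ^^ k) x)) - h x) \<le> 2 * real n * \<epsilon>" if jk: "j < n" "k < n" for j k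
  proof -
    note Tk = measure_preserving_funpow[OF T, of k]
    note d = Lp_fun_diff[OF p Lp_fun_measure_preserving[OF measure_preserving_funpow[OF S, of j] h] h]
    have "Lp_norm M p (\<lambda>x. (h ((S ^^ j) ((T ^^ k) x)) - h ((T ^^ k) x)) + (h ((T ^^ k) x) - h x))
      \<le> Lp_norm M p (\<lambda>x. h ((S ^^ j) ((T ^^ k) x)) - h ((T ^^ k) x)) + Lp_norm M p (\<lambda>x. h ((T ^^ k) x) - h x)"
      by (intro Lp_norm_triangle p Lp_fun_measure_preserving[OF Tk d] Lp_fun_diff Lp_fun_measure_preserving[OF Tk h] h)
    also have "Lp_norm M p (\<lambda>x. h ((S ^^ j) ((T ^^ k) x)) - h ((T ^^ k) x)) = Lp_norm M p (\<lambda>x. h ((S ^^ j) x) - h x)"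
      by (rule Lp_norm_measure_preserving[OF Tk d])
    also have "\<dots> + Lp_norm M p (\<lambda>x. h ((T ^^ k) x) - h x) \<le> real j * \<epsilon> + real k * \<epsilon>"
      by (intro add_mono Lp_norm_funpow_diff_le T S p h hT hS)
    also have "\<dots> \<le> real n * \<epsilon> + real n * \<epsilon>"
      using jk \<epsilon> by (intro add_mono mult_right_mono) auto
    finally show ?thesis by (simp add: mult_ac)
  qed
  have d: "(\<lambda>x. h ((S ^^ j) ((T ^^ k) x)) - h x) \<in> Lp_fun M p" for j k
    by (rule Lp_fun_diff[OF p hTS h])
  have "Lp_norm M p (\<lambda>x. \<Sum>k<n. \<Sum>j<n. h ((S ^^ j) ((T ^^ k) x)) - h x)
      \<le> (\<Sum>k<n. Lp_norm M p (\<lambda>x. \<Sum>j<n. h ((S ^^ j) ((T ^^ k) x)) - h x))"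
    by (intro Lp_norm_sum Lp_fun_sum p d)
  also have "\<dots> \<le> (\<Sum>k<n. \<Sum>j<n. Lp_norm M p (\<lambda>x. h ((S ^^ j) ((T ^^ k) x)) - h x))"
    by (intro sum_mono Lp_norm_sum p d)
  also have "\<dots> \<le> (\<Sum>k<n. \<Sum>j<n. 2 * real n * \<epsilon>)"
    using close by (intro sum_mono) auto
  finally have *: "1 / real n * Lp_norm M p (\<lambda>x. \<Sum>k<n. \<Sum>j<n. h ((S ^^ j) ((T ^^ k) x)) - h x)
      \<le> 1 / real n * (real n * (real n * (2 * real n * \<epsilon>)))"
    by (intro mult_left_mono) auto
  have "real n * Lp_norm M p h = Lp_norm M p (\<lambda>x. real n *\<^sub>R h x)"
    by (simp add: Lp_norm_scaleR[OF p])
  also have "\<dots> \<le> Lp_norm M p (square_average T S n h) + Lp_norm M p (\<lambda>x. real n *\<^sub>R h x - square_average T S n h x)"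
    by (intro Lp_norm_reverse_triangle p Lp_fun_scaleR h square_average_Lp T S)
  also have "(\<lambda>x. real n *\<^sub>R h x - square_average T S n h x)
      = (\<lambda>x. (- (1 / real n)) *\<^sub>R (\<Sum>k<n. \<Sum>j<n. h ((S ^^ j) ((T ^^ k) x)) - h x))"
    using False by (simp add: square_average_def sum_subtractf scaleR_right_diff_distrib fun_eq_iff sum_constant_scaleR)
  also have "Lp_norm M p \<dots> \<le> real n * (2 * real n * \<epsilon>)"
    using * False unfolding Lp_norm_scaleR[OF p] by simp
  finally show ?thesis by (simp add: right_diff_distrib)
qed simp

text \<open>The \<open>u\<close> part telescopes along \<open>T\<close>, the \<open>v\<close> part
  along \<open>S\<close>. Each leaves \<open>n\<close> differences of norm at most twice that of
  \<open>u\<close> or \<open>v\<close>, which the factor \<open>1 / n\<close> exactly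
  compensates.\<close>

lemma square_average_coboundary_bounded:
  fixes f u v :: "'a \<Rightarrow> 'b::{banach, second_countable_topology}"
  assumes T: "measure_preserving M T" and S: "measure_preserving M S"
    and comm: "\<And>x. x \<in> space M \<Longrightarrow> T (S x) = S (T x)" and p: "1 \<le> p"
    and f: "f \<in> Lp_fun M p" and u: "u \<in> Lp_fun M p" and v: "v \<in> Lp_fun M p"
    and eq: "AE x in M. f x = (u x - u (T x)) + (v x - v (S x))"
  shows "Lp_norm M p (square_average T S n f) \<le> 2 * Lp_norm M p u + 2 * Lp_norm M p v"
proof (cases "n = 0")
  case False
  have TS: "measure_preserving M (\<lambda>x. (S ^^ j) ((T ^^ k) x))" for j k
    using measure_preserving_comp[OF measure_preserving_funpow[OF S] measure_preserving_funpow[OF T]]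
    by (simp add: comp_def)
  \<comment> \<open>The terms that survive telescoping: differences between opposite edges of the
    square.\<close>
  let ?a = "\<lambda>j x. u ((S ^^ j) x) - u ((S ^^ j) ((T ^^ n) x))"
  let ?b = "\<lambda>k x. v ((T ^^ k) x) - v ((S ^^ n) ((T ^^ k) x))"
  have a: "?a j \<in> Lp_fun M p" "Lp_norm M p (?a j) \<le> 2 * Lp_norm M p u" for j
    using Lp_norm_triangle_diff[OF p Lp_fun_measure_preserving[OF TS u, of j 0] Lp_fun_measure_preserving[OF TS u, of j n]]
      Lp_fun_diff[OF p Lp_fun_measure_preserving[OF TS u, of j 0] Lp_fun_measure_preserving[OF TS u, of j n]]
      Lp_norm_measure_preserving[OF TS u, of j 0] Lp_norm_measure_preserving[OF TS u, of j n] by simp_all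
  have b: "?b k \<in> Lp_fun M p" "Lp_norm M p (?b k) \<le> 2 * Lp_norm M p v" for k
    using Lp_norm_triangle_diff[OF p Lp_fun_measure_preserving[OF TS v, of 0 k] Lp_fun_measure_preserving[OF TS v, of n k]]
      Lp_fun_diff[OF p Lp_fun_measure_preserving[OF TS v, of 0 k] Lp_fun_measure_preserving[OF TS v, of n k]]
      Lp_norm_measure_preserving[OF TS v, of 0 k] Lp_norm_measure_preserving[OF TS v, of n k] by simp_all
  have ab: "(\<lambda>x. \<Sum>j<n. ?a j x) \<in> Lp_fun M p" "(\<lambda>x. \<Sum>k<n. ?b k x) \<in> Lp_fun M p"
    by (intro Lp_fun_sum p a b)+
  let ?w = "\<lambda>x. (\<Sum>j<n. ?a j x) + (\<Sum>k<n. ?b k x)"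
  have w: "?w \<in> Lp_fun M p" by (rule Lp_fun_add[OF p ab])
  \<comment> \<open>The coboundary equation holds only almost everywhere; as there are countably
    many pairs \<open>j\<close>, \<open>k\<close>, one null set serves all iterates.\<close>
  have "AE x in M. \<forall>j k. f ((S ^^ j) ((T ^^ k) x)) =
      (u ((S ^^ j) ((T ^^ k) x)) - u (T ((S ^^ j) ((T ^^ k) x)))) + (v ((S ^^ j) ((T ^^ k) x)) - v (S ((S ^^ j) ((T ^^ k) x))))"
    unfolding AE_all_countable using AE_measure_preserving[OF TS eq] by blast
  then have "AE x in M. square_average T S n f x = (1 / real n) *\<^sub>R ?w x"
    using AE_space
  proof eventually_elim
    case (elim x)
    have comm': "T ((S ^^ j) ((T ^^ k) x)) = (S ^^ j) ((T ^^ Suc k) x)" for j k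
      using funpow_commute_on_space[OF S T comm[symmetric] funpow_in_space[OF T elim(2)], of j k] by simp
    have "(\<Sum>k<n. \<Sum>j<n. f ((S ^^ j) ((T ^^ k) x)))
        = (\<Sum>k<n. \<Sum>j<n. u ((S ^^ j) ((T ^^ k) x)) - u ((S ^^ j) ((T ^^ Suc k) x)))
        + (\<Sum>k<n. \<Sum>j<n. v ((S ^^ j) ((T ^^ k) x)) - v ((S ^^ Suc j) ((T ^^ k) x)))"
      by (subst elim(1)[rule_format]) (simp only: comm' sum.distrib funpow.simps comp_apply)
    \<comment> \<open>The sums are exchanged so that the inner one runs over \<open>k\<close>, the
      direction in which the \<open>u\<close> terms telescope.\<close>
    also have "(\<Sum>k<n. \<Sum>j<n. u ((S ^^ j) ((T ^^ k) x)) - u ((S ^^ j) ((T ^^ Suc k) x))) = (\<Sum>j<n. ?a j x)"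
      by (subst sum.swap) (simp only: sum_lessThan_telescope'[of "\<lambda>k. u ((S ^^ j) ((T ^^ k) x))" for j] funpow_0)
    also have "(\<Sum>k<n. \<Sum>j<n. v ((S ^^ j) ((T ^^ k) x)) - v ((S ^^ Suc j) ((T ^^ k) x))) = (\<Sum>k<n. ?b k x)"
      by (simp only: sum_lessThan_telescope'[of "\<lambda>j. v ((S ^^ j) ((T ^^ k) x))" for k] funpow_0)
    finally show ?case by (simp add: square_average_def)
  qed
  then have "Lp_norm M p (square_average T S n f) = Lp_norm M p (\<lambda>x. (1 / real n) *\<^sub>R ?w x)"
    by (intro Lp_norm_cong_AE Lp_funD(1)[OF square_average_Lp(1)[OF T S p f]] Lp_funD(1)[OF Lp_fun_scaleR[OF w]])
  also have "\<dots> = 1 / real n * Lp_norm M p ?w" by (simp add: Lp_norm_scaleR[OF p])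
  also have "\<dots> \<le> 1 / real n * (real n * (2 * Lp_norm M p u) + real n * (2 * Lp_norm M p v))"
  proof (intro mult_left_mono)
    have "Lp_norm M p ?w \<le> Lp_norm M p (\<lambda>x. \<Sum>j<n. ?a j x) + Lp_norm M p (\<lambda>x. \<Sum>k<n. ?b k x)"
      by (rule Lp_norm_triangle[OF p ab])
    also have "\<dots> \<le> (\<Sum>j<n. Lp_norm M p (?a j)) + (\<Sum>k<n. Lp_norm M p (?b k))"
      by (intro add_mono Lp_norm_sum p a b)
    also have "\<dots> \<le> (\<Sum>j<n. 2 * Lp_norm M p u) + (\<Sum>k<n. 2 * Lp_norm M p v)"
      by (intro add_mono sum_mono a b)
    finally show "Lp_norm M p ?w \<le> real n * (2 * Lp_norm M p u) + real n * (2 * Lp_norm M p v)" by simp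
  qed simp
  also have "\<dots> = 2 * Lp_norm M p u + 2 * Lp_norm M p v"
    using False by (simp add: field_simps)
  finally show ?thesis .
qed (simp add: square_average_def Lp_norm_zero[unfolded Lp_norm_def] Lp_norm_def)

text \<open>Generic in the value space, to serve real and complex scalars alike. Equality of classes
  gives a representation almost everywhere, which is all the uniform bound asks for.\<close>

lemma Lp_class_notin_coboundaries:
  fixes f :: "'a \<Rightarrow> 'b::{banach, second_countable_topology}"
  assumes T: "measure_preserving M T" and S: "measure_preserving M S"
    and comm: "\<And>x. x \<in> space M \<Longrightarrow> T (S x) = S (T x)" and p: "1 \<le> p" and f: "f \<in> Lp_fun M p"
    and unbounded: "\<And>B. \<exists>n. B < Lp_norm M p (square_average T S n f)"
  shows "Lp_class M p f \<notin> Lp_coboundaries M p T S"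
proof
  assume "Lp_class M p f \<in> Lp_coboundaries M p T S"
  then obtain u v where uv: "u \<in> Lp_fun M p" "v \<in> Lp_fun M p"
    and eq: "Lp_class M p f = Lp_class M p (\<lambda>x. (u x - koopman T u x) + (v x - koopman S v x))"
    unfolding Lp_coboundaries_def by blast
  have "(\<lambda>x. (u x - koopman T u x) + (v x - koopman S v x)) \<in> Lp_fun M p"
    by (intro Lp_fun_add Lp_fun_diff koopman_Lp_fun p T S uv)
  with eq have "AE x in M. f x = (u x - u (T x)) + (v x - v (S x))"
    by (simp add: Lp_class_eq_iff[OF f] koopman_def)
  from square_average_coboundary_bounded[OF T S comm p f uv this]
  show False using unbounded by (meson not_less)
qed

context prob_space
begin

text \<open>Gliding hump: at step \<open>i\<close> one of the two signs in \<open>F \<plusminus> 4\<^sup>-\<^sup>i h\<close>, with \<open>h\<close> almost invariant at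
  scale \<open>16\<^sup>i\<close>, makes the average at scale \<open>16\<^sup>i\<close> at least \<open>4\<^sup>i/2\<close>; all later steps together
  reduce it by at most \<open>4\<^sup>i/3\<close>.\<close>

lemma square_average_unbounded:
  assumes na: "non_atomic M" and T: "measure_preserving M T" and S: "measure_preserving M S"
    and comm: "\<And>x. x \<in> space M \<Longrightarrow> T (S x) = S (T x)" and p: "1 \<le> p"
  shows "\<exists>f :: 'a \<Rightarrow> real. f \<in> Lp_fun M p \<and> (\<integral>x. f x \<partial>M) = 0 \<and>
    (\<forall>i. 4 ^ i / 6 \<le> Lp_norm M p (square_average T S (16 ^ i) f))"
proof -
  let ?A = "\<lambda>i. square_average T S (16 ^ i)"
  note A = square_average_Lp[OF T S p]
  define P where "P F \<longleftrightarrow> F \<in> Lp_fun M p \<and> (\<integral>x. F x \<partial>M) = 0" for F :: "'a \<Rightarrow> real"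
  define Q where "Q i F G \<longleftrightarrow> Lp_norm M p (\<lambda>x. G x - F x) \<le> (1 / 4) ^ i \<and> 4 ^ i / 2 \<le> Lp_norm M p (?A i G)"
    for i and F G :: "'a \<Rightarrow> real"
  have step: "\<exists>G. P G \<and> Q i F G" if F: "P F" for i F
  proof -
    \<comment> \<open>The tolerance makes \<open>1 - 2 * 16^i * \<epsilon>\<close> equal to
      \<open>1 / 2\<close>, so the average of \<open>h\<close> at scale \<open>16^i\<close> has norm
      at least \<open>16^i / 2\<close>.\<close>
    obtain h :: "'a \<Rightarrow> real" where h: "h \<in> Lp_fun M p" "(\<integral>x. h x \<partial>M) = 0" "Lp_norm M p h = 1"
      and hT: "Lp_norm M p (\<lambda>x. h (T x) - h x) \<le> 1 / (4 * 16 ^ i)"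
      and hS: "Lp_norm M p (\<lambda>x. h (S x) - h x) \<le> 1 / (4 * 16 ^ i)"
      by (rule almost_invariant_function[OF na T S comm p, of "1 / (4 * 16 ^ i)"]) auto
    have Ah: "16 ^ i / 2 \<le> Lp_norm M p (?A i h)"
      using square_average_almost_invariant[OF T S p h(1) hT hS, of "16 ^ i"] by (simp add: h(3))
    define g where "g x = (1 / 4) ^ i *\<^sub>R h x" for x
    have g: "g \<in> Lp_fun M p" "Lp_norm M p g = (1 / 4) ^ i" "(\<integral>x. g x \<partial>M) = 0"
      using h unfolding g_def[abs_def] Lp_norm_scaleR[OF p] by (simp_all add: Lp_fun_scaleR del: real_scaleR_def)
    have "4 ^ i / 2 = (1 / 4) ^ i * (16 ^ i / (2 :: real))"
      using power_mult_distrib[of "1 / 4 :: real" 16 i] by simp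
    also have "\<dots> \<le> Lp_norm M p (?A i g)"
      using mult_left_mono[OF Ah, of "(1 / 4) ^ i"]
      unfolding g_def[abs_def] square_average_scaleR Lp_norm_scaleR[OF p] by simp
    finally have Ag: "4 ^ i / 2 \<le> Lp_norm M p (?A i g)" .
    have FL: "F \<in> Lp_fun M p" "(\<integral>x. F x \<partial>M) = 0" using F by (auto simp: P_def)
    let ?p = "\<lambda>x. F x + g x" and ?m = "\<lambda>x. F x - g x"
    have pm: "?p \<in> Lp_fun M p" "?m \<in> Lp_fun M p" by (intro Lp_fun_add Lp_fun_diff p FL g)+
    \<comment> \<open>Whatever the average of \<open>F\<close> is, the averages of
      \<open>F + g\<close> and \<open>F - g\<close> differ by twice that of \<open>g\<close>, so
      they cannot both be smaller than it.\<close>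
    have "2 * Lp_norm M p (?A i g) = Lp_norm M p (\<lambda>x. ?A i ?p x - ?A i ?m x)"
      using Lp_norm_scaleR[OF p, of M 2 "?A i g"]
      by (simp add: square_average_add square_average_diff)
    also have "\<dots> \<le> Lp_norm M p (?A i ?p) + Lp_norm M p (?A i ?m)"
      by (intro Lp_norm_triangle_diff p A pm)
    finally have "4 ^ i / 2 \<le> Lp_norm M p (?A i ?p) \<or> 4 ^ i / 2 \<le> Lp_norm M p (?A i ?m)"
      using Ag by linarith
    then have "Q i F ?p \<or> Q i F ?m"
      using g(2) Lp_norm_uminus[of M p g] by (simp add: Q_def)
    moreover have "P ?p" "P ?m"
      using pm FL g(3) integrable_Lp_fun[OF FL(1) p] integrable_Lp_fun[OF g(1) p] by (auto simp: P_def)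
    ultimately show ?thesis by blast
  qed
  have "\<exists>F. \<forall>i. P (F i) \<and> Q i (F i) (F (Suc i))"
  proof (rule dependent_nat_choice)
    show "\<exists>F. P F" by (intro exI[of _ "\<lambda>x. 0"]) (simp add: P_def Lp_fun_zero)
  qed (rule step)
  then obtain F where "\<And>i. P (F i)" "\<And>i. Q i (F i) (F (Suc i))" by blast
  then have F: "F i \<in> Lp_fun M p" and F0: "(\<integral>x. F i x \<partial>M) = 0"
    and inc: "Lp_norm M p (\<lambda>x. F (Suc i) x - F i x) \<le> (1 / 4) ^ i"
    and big: "4 ^ i / 2 \<le> Lp_norm M p (?A i (F (Suc i)))" for i
    by (auto simp: P_def Q_def)
  \<comment> \<open>The geometric tail of \<open>(1 / 4) ^ k\<close> over \<open>k \<ge> i\<close>.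
    Since \<open>b m - b (Suc m) = (1 / 4) ^ m\<close>, subtracting \<open>b m\<close> in the next
    claim makes its induction close.\<close>
  define b :: "nat \<Rightarrow> real" where "b i = 4 / 3 * (1 / 4) ^ i" for i
  have Cauchy: "Lp_norm M p (\<lambda>x. F m x - F i x) \<le> b i - b m" if "i \<le> m" for i m
    using that
  proof (induction m rule: dec_induct)
    case base
    then show ?case by (simp add: Lp_norm_zero)
  next
    case (step m)
    have "Lp_norm M p (\<lambda>x. (F (Suc m) x - F m x) + (F m x - F i x))
        \<le> Lp_norm M p (\<lambda>x. F (Suc m) x - F m x) + Lp_norm M p (\<lambda>x. F m x - F i x)"
      by (intro Lp_norm_triangle Lp_fun_diff p F)
    with inc[of m] step.IH show ?case by (simp add: b_def)
  qed
  have b0: "0 \<le> b i" for i by (simp add: b_def)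
  have sb: "summable b" unfolding b_def by (intro summable_mult summable_geometric) simp
  have cb: "Lp_norm M p (\<lambda>x. F m x - F i x) \<le> b i" if "i \<le> m" for i m
    using Cauchy[OF that] b0[of m] by linarith
  from Lp_fun_complete[OF p F sb cb]
  obtain f where f: "f \<in> Lp_fun M p" and lim: "\<forall>i. Lp_norm M p (\<lambda>x. f x - F i x) \<le> b i" ..
  have d: "(\<lambda>x. f x - F i x) \<in> Lp_fun M p" for i by (intro Lp_fun_diff p f F)
  show ?thesis
  proof (intro exI[of _ f] conjI allI)
    show "f \<in> Lp_fun M p" by fact
    have le: "\<bar>\<integral>x. f x \<partial>M\<bar> \<le> 2 * b i" for i
      using norm_integral_le_Lp_norm[OF d p, of i] lim[rule_format, of i] F0[of i]
        integrable_Lp_fun[OF f p] integrable_Lp_fun[OF F p] by simp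
    have "(\<lambda>i. 2 * b i) \<longlonglongrightarrow> 2 * (4 / 3 * 0)"
      unfolding b_def by (intro tendsto_mult tendsto_const LIMSEQ_realpow_zero) auto
    then have "\<bar>\<integral>x. f x \<partial>M\<bar> \<le> 2 * (4 / 3 * 0)"
      using le by (meson LIMSEQ_le_const)
    then show "(\<integral>x. f x \<partial>M) = 0" by simp
    show "4 ^ i / 6 \<le> Lp_norm M p (?A i f)" for i
    proof -
      \<comment> \<open>Hump \<open>i\<close> is first present in \<open>F (Suc i)\<close>, so the
        remaining tail is \<open>b (Suc i)\<close>, which is \<open>(1 / 4) ^ i / 3\<close>. At
        operator norm \<open>16^i\<close> it costs \<open>4^i / 3\<close>, leaving
        \<open>4^i / 6\<close>.\<close>
      have "4 ^ i / 2 \<le> Lp_norm M p (?A i (F (Suc i)))" by (rule big)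
      also have "\<dots> = Lp_norm M p (\<lambda>x. ?A i f x - ?A i (\<lambda>x. f x - F (Suc i) x) x)"
        by (simp add: square_average_diff)
      also have "\<dots> \<le> Lp_norm M p (?A i f) + Lp_norm M p (?A i (\<lambda>x. f x - F (Suc i) x))"
        by (intro Lp_norm_triangle_diff p A f d)
      also have "Lp_norm M p (?A i (\<lambda>x. f x - F (Suc i) x)) \<le> real (16 ^ i) * b (Suc i)"
        using A(2)[OF d, of "16 ^ i" "Suc i"] mult_left_mono[OF lim[rule_format, of "Suc i"], of "real (16 ^ i)"] by linarith
      also have "real (16 ^ i) * b (Suc i) = 4 ^ i / 3"
        by (simp add: b_def power_divide field_simps flip: power_mult_distrib)
      finally show ?thesis by simp
    qed
  qed
qed

end

section \<open>Non-closedness and the positive upper limit\<close>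

lemma koopman_funpow: "(koopman T ^^ n) f x = f ((T ^^ n) x)"
proof (induction n arbitrary: x)
  case (Suc n)
  have "(koopman T ^^ Suc n) f x = (koopman T ^^ n) f (T x)"
    by (simp add: koopman_def[of T "(koopman T ^^ n) f"])
  then show ?case by (simp add: Suc.IH funpow_swap1)
qed simp

theorem theorem5p5:
  fixes M :: "'a measure" and \<theta> \<tau> :: "'a \<Rightarrow> 'a" and p :: real
  assumes "prob_space M" and "non_atomic M"
    and "measure_preserving M \<theta>" and "measure_preserving M \<tau>"
    and "ergodic M \<theta>" and "ergodic M \<tau>"
    and "\<And>x. x \<in> space M \<Longrightarrow> \<theta> (\<tau> x) = \<tau> (\<theta> x)"
    and "free_action M \<theta> \<tau>"
    and "1 \<le> p"
  shows "\<not> closedin (Lp_topology M p) (Lp_coboundaries M p \<theta> \<tau> :: ('a \<Rightarrow> real) set set)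
    \<and> \<not> closedin (Lp_topology M p) (Lp_coboundaries M p \<theta> \<tau> :: ('a \<Rightarrow> complex) set set)
    \<and> (\<exists>f :: 'a \<Rightarrow> real. f \<in> Lp_fun M p \<and> (\<integral>x. f x \<partial>M) = 0 \<and>
         limsup (\<lambda>n. ereal (Lp_norm M p (\<lambda>x. 1 / real n *
           (\<Sum>k<n. \<Sum>j<n. (koopman \<theta> ^^ k) ((koopman \<tau> ^^ j) f) x)))) > 0)"
proof -
  interpret prob_space M by fact
  note mp = assms(3,4) and comm = assms(7) and p = assms(9)
  \<comment> \<open>One function serves all three claims: it is the missing limit point, over the
    reals and after embedding over the complex numbers, and the witness for the upper limit.\<close>
  obtain f :: "'a \<Rightarrow> real" where f: "f \<in> Lp_fun M p" "(\<integral>x. f x \<partial>M) = 0"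
    and big: "\<forall>i. 4 ^ i / 6 \<le> Lp_norm M p (square_average \<theta> \<tau> (16 ^ i) f)"
    using square_average_unbounded[OF assms(2) mp comm p] by blast

  have unbounded: "\<exists>n. B < Lp_norm M p (square_average \<theta> \<tau> n f)" for B
  proof -
    obtain i where "6 * B < 4 ^ i" using real_arch_pow[of 4] by auto
    with big[rule_format, of i] show ?thesis by (intro exI[of _ "16 ^ i"]) simp
  qed

  have real: "\<not> closedin (Lp_topology M p) (Lp_coboundaries M p \<theta> \<tau> :: ('a \<Rightarrow> real) set set)"
  proof
    assume closed: "closedin (Lp_topology M p) (Lp_coboundaries M p \<theta> \<tau> :: ('a \<Rightarrow> real) set set)"
    have "Lp_class M p f \<in> Lp_coboundaries M p \<theta> \<tau>"
    proof (rule Lp_closedin_limit[OF p closed f(1)])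
      fix e :: real assume "0 < e"
      then obtain u where u: "u \<in> Lp_fun M p" "Lp_norm M p (\<lambda>x. f x - (u x - u (\<theta> x))) < e"
        using coboundary_approx[OF mp(1) assms(5) p f] by blast
      moreover have "(\<lambda>x. u x - u (\<theta> x)) \<in> Lp_fun M p"
        by (intro Lp_fun_diff p u Lp_fun_measure_preserving[OF mp(1)])
      \<comment> \<open>A coboundary of \<open>\<theta>\<close>, completed by the zero function in
        the \<open>\<tau>\<close> component.\<close>
      moreover have "Lp_class M p (\<lambda>x. u x - u (\<theta> x)) \<in> Lp_coboundaries M p \<theta> \<tau>"
        unfolding Lp_coboundaries_def
        by (intro CollectI exI[of _ u] exI[of _ "\<lambda>x. 0"]) (simp add: u Lp_fun_zero koopman_def comp_def)
      ultimately show "\<exists>g\<in>Lp_fun M p. Lp_class M p g \<in> Lp_coboundaries M p \<theta> \<tau> \<and> Lp_norm M p (\<lambda>x. f x - g x) < e"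
        by blast
    qed
    with Lp_class_notin_coboundaries[OF mp comm p f(1) unbounded] show False by simp
  qed

  \<comment> \<open>The embedding of the reals preserves norms and commutes with averaging, so both
    the approximants and the unbounded averages of \<open>f\<close> carry over.\<close>
  let ?f = "\<lambda>x. complex_of_real (f x)"
  have complex: "\<not> closedin (Lp_topology M p) (Lp_coboundaries M p \<theta> \<tau> :: ('a \<Rightarrow> complex) set set)"
  proof
    assume closed: "closedin (Lp_topology M p) (Lp_coboundaries M p \<theta> \<tau> :: ('a \<Rightarrow> complex) set set)"
    have f': "?f \<in> Lp_fun M p" using f by (simp add: Lp_fun_of_real_iff)
    have "Lp_class M p ?f \<in> Lp_coboundaries M p \<theta> \<tau>"
    proof (rule Lp_closedin_limit[OF p closed f'])
      fix e :: real assume "0 < e"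
      then obtain u where u: "u \<in> Lp_fun M p" "Lp_norm M p (\<lambda>x. f x - (u x - u (\<theta> x))) < e"
        using coboundary_approx[OF mp(1) assms(5) p f] by blast
      define w where "w x = complex_of_real (u x)" for x
      have w: "w \<in> Lp_fun M p" using u by (simp add: w_def[abs_def] Lp_fun_of_real_iff)
      have "Lp_norm M p (\<lambda>x. ?f x - (w x - w (\<theta> x))) < e"
        using u(2) Lp_norm_of_real[of M p "\<lambda>x. f x - (u x - u (\<theta> x))"] by (simp add: w_def)
      moreover have "(\<lambda>x. w x - w (\<theta> x)) \<in> Lp_fun M p"
        by (intro Lp_fun_diff p w Lp_fun_measure_preserving[OF mp(1)])
      moreover have "Lp_class M p (\<lambda>x. w x - w (\<theta> x)) \<in> Lp_coboundaries M p \<theta> \<tau>"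
        unfolding Lp_coboundaries_def
        by (intro CollectI exI[of _ w] exI[of _ "\<lambda>x. 0"]) (simp add: w Lp_fun_zero koopman_def comp_def)
      ultimately show "\<exists>g\<in>Lp_fun M p. Lp_class M p g \<in> Lp_coboundaries M p \<theta> \<tau> \<and> Lp_norm M p (\<lambda>x. ?f x - g x) < e"
        by blast
    qed
    moreover have "square_average \<theta> \<tau> n ?f = (\<lambda>x. complex_of_real (square_average \<theta> \<tau> n f x))" for n
      by (simp add: square_average_def fun_eq_iff scaleR_conv_of_real)
    ultimately show False using Lp_class_notin_coboundaries[OF mp comm p f'] unbounded by (simp add: Lp_norm_of_real)
  qed

  \<comment> \<open>Composition operators reverse order: \<open>U^k V^j f\<close> evaluates
    \<open>f\<close> at \<open>\<tau>^j (\<theta>^k x)\<close>, the order built into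
    \<open>square_average\<close>.\<close>
  have avg: "(\<lambda>x. 1 / real n * (\<Sum>k<n. \<Sum>j<n. (koopman \<theta> ^^ k) ((koopman \<tau> ^^ j) f) x)) = square_average \<theta> \<tau> n f" for n
    by (simp add: square_average_def koopman_funpow fun_eq_iff)
  have "0 < limsup (\<lambda>n. ereal (Lp_norm M p (square_average \<theta> \<tau> n f)))"
  proof (rule ccontr)
    assume "\<not> ?thesis"
    \<comment> \<open>An upper limit below \<open>1 / 6\<close> would keep all late averages below
      \<open>1 / 6\<close>, yet at \<open>16^N \<ge> N\<close> the norm is at least
      \<open>4^N / 6\<close>.\<close>
    then have "limsup (\<lambda>n. ereal (Lp_norm M p (square_average \<theta> \<tau> n f))) < ereal (1 / 6)"
      by (simp add: not_less le_less_trans)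
    from Limsup_lessD[OF this]
    obtain N where N: "\<And>n. N \<le> n \<Longrightarrow> Lp_norm M p (square_average \<theta> \<tau> n f) < 1 / 6"
      by (auto simp: eventually_sequentially)
    have "N \<le> 16 ^ N" by (rule less_imp_le, rule power_gt_expt) simp
    from N[OF this] big[rule_format, of N] have "(4 :: real) ^ N < 1" by linarith
    moreover have "1 \<le> (4 :: real) ^ N" by (rule one_le_power) simp
    ultimately show False by linarith
  qed
  then show ?thesis
    by (intro conjI exI[of _ f] real complex f) (simp only: avg)
qed

end
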